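(* There exists an absolute constant $c>0$ such that for every $n\geqslant 3$, every centered convex body $K$ in $\mathbb{R}^n$ and every pair of orthogonal unit vectors $u,v\in\mathbb{R}^n$, setting $E_{uv}=(\mathrm{span}\{u,v\})^{\perp}$, $$|K\cap u^{\perp}|\,|K\cap v^{\perp}|\leqslant c\,|K\cap E_{uv}|\,|K|.$$ *)

theory Defs
  imports "HOL-Analysis.Analysis"
begin

text \<open>R^n is modelled as the extensional functions nat => real on {..<n}
  (value undefined outside), i.e. the space of the product measure below.\<close>

definition Rn :: "nat \<Rightarrow> (nat \<Rightarrow> real) set" where
  "Rn n = PiE {..<n} (\<lambda>_. UNIV)"

definition lebn :: "nat \<Rightarrow> (nat \<Rightarrow> real) measure" where
  "lebn n = PiM {..<n} (\<lambda>_. lborel)"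

definition ipr :: "nat \<Rightarrow> (nat \<Rightarrow> real) \<Rightarrow> (nat \<Rightarrow> real) \<Rightarrow> real" where
  "ipr n x y = (\<Sum>i<n. x i * y i)"

definition distn :: "nat \<Rightarrow> (nat \<Rightarrow> real) \<Rightarrow> (nat \<Rightarrow> real) \<Rightarrow> real" where
  "distn n x y = sqrt (\<Sum>i<n. (x i - y i)\<^sup>2)"

definition convex_n :: "nat \<Rightarrow> (nat \<Rightarrow> real) set \<Rightarrow> bool" where
  "convex_n n K \<longleftrightarrow> (\<forall>x\<in>K. \<forall>y\<in>K. \<forall>t::real. 0 \<le> t \<and> t \<le> 1 \<longrightarrow>
      (\<lambda>i. if i < n then (1 - t) * x i + t * y i else undefined) \<in> K)"

text \<open>Convex body: compact convex subset of R^n with nonempty interior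
  (compactness w.r.t. the product topology, which on R^n is the Euclidean one).\<close>
definition convex_body :: "nat \<Rightarrow> (nat \<Rightarrow> real) set \<Rightarrow> bool" where
  "convex_body n K \<longleftrightarrow> K \<subseteq> Rn n \<and> compact K \<and> convex_n n K \<and>
     (\<exists>x\<in>K. \<exists>r>0. {y \<in> Rn n. distn n x y < r} \<subseteq> K)"

definition centered :: "nat \<Rightarrow> (nat \<Rightarrow> real) set \<Rightarrow> bool" where
  "centered n K \<longleftrightarrow> (\<forall>i<n. (LINT x:K|lebn n. x i) = 0)"

definition vol :: "nat \<Rightarrow> (nat \<Rightarrow> real) set \<Rightarrow> real" where
  "vol n K = measure (lebn n) K"

definition orthonormal_fam :: "nat \<Rightarrow> nat \<Rightarrow> (nat \<Rightarrow> nat \<Rightarrow> real) \<Rightarrow> bool" where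
  "orthonormal_fam n k b \<longleftrightarrow> (\<forall>j<k. b j \<in> Rn n) \<and>
     (\<forall>j<k. \<forall>l<k. ipr n (b j) (b l) = (if j = l then 1 else 0))"

definition embed :: "nat \<Rightarrow> nat \<Rightarrow> (nat \<Rightarrow> nat \<Rightarrow> real) \<Rightarrow> (nat \<Rightarrow> real) \<Rightarrow> (nat \<Rightarrow> real)" where
  "embed n k b y = (\<lambda>i. if i < n then (\<Sum>j<k. y j * b j i) else undefined)"

text \<open>k-dimensional volume of K \<inter> W, where b is an orthonormal basis of the
  k-dimensional subspace W: Lebesgue measure of the preimage of K under the
  linear isometry R^k \<rightarrow> W, y \<mapsto> \<Sum> y_j b_j.\<close>
definition secvol :: "nat \<Rightarrow> nat \<Rightarrow> (nat \<Rightarrow> nat \<Rightarrow> real) \<Rightarrow> (nat \<Rightarrow> real) set \<Rightarrow> real" where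
  "secvol n k b K = measure (lebn k) {y \<in> Rn k. embed n k b y \<in> K}"

end

theory Submission
  imports Defs
begin

text \<open>Write \<open>f(t, s)\<close> for the \<open>(n - 2)\<close>-volume of \<open>K \<inter> (t v + s u + E\<^sub>u\<^sub>v)\<close>. By Brunn-Minkowski \<open>f\<close> is
  log-concave on the plane, and its barycentre is the origin. The four volumes are \<open>\<integral> f(t, 0) dt\<close>,
  \<open>\<integral> f(0, s) ds\<close>, \<open>f(0, 0)\<close> and \<open>\<integral>\<integral> f\<close>. If \<open>M\<close> bounds \<open>f\<close>, then
  \<open>f(t, 0) f(0, s) / M \<le> sqrt (f(t, 0) f(0, s)) \<le> f(t/2, s/2)\<close>, and integrating gives the inequality
  with constant \<open>4 M / f(0, 0)\<close>. Finally \<open>M = e\<^sup>6 f(0, 0)\<close> is admissible: Jensen's inequality for \<open>ln f\<close>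
  at the barycentre bounds \<open>ln f(0, 0)\<close> below by the mean of \<open>ln f\<close> with respect to \<open>f\<close>, and
  \<open>sqrt r \<ge> r - r ln r / 2\<close> applied to \<open>r = f(p) / f(z)\<close>, together with
  \<open>sqrt (f(z) f(p)) \<le> f((z + p)/2)\<close>, bounds that mean below by \<open>ln f(z) - 6\<close> for every \<open>z\<close>.\<close>

section \<open>The Prekopa-Leindler inequality on the line\<close>

text \<open>The dimension \<open>n\<close> enters only through log-concavity of the section
  function; all later estimates take place in the plane, whence a constant free of \<open>n\<close>.
  Both of its factors stem from the halving map p -> (z + p)/2, whose Jacobian in the plane is 1/4.
  It gives the 4 directly, and integrating r - r ln r / 2 <= sqrt r <= r((z + p)/2), with r = f /
  f(z), shows that the mean of ln r is at least -2 (4 - 1) = -6. For a body that is not centred f(0,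
  0) may vanish while both hyperplane sections are large, so the comparison of f(0, 0) with the
  maximum is the heart of the matter, and even its positivity has to come out of the barycentre
  condition. Brunn-Minkowski is used in multiplicative form: its exponents do not involve the
  dimension, so it passes through an induction over coordinates. Sections are measured in arbitrary
  orthonormal bases, whereas slicing needs coordinates. The body is therefore pulled back along a
  basis ending in v, u, which rests on invariance of product Lebesgue measure under orthogonal maps,
  in the whole space and inside each hyperplane.\<close>

lemma brunn_minkowski_real:
  fixes A B C :: "real set"
  assumes AB: "A \<in> sets borel" "B \<in> sets borel" and C [measurable]: "C \<in> sets borel"
    and "A \<noteq> {}" "B \<noteq> {}" and bdd: "bdd_above A" "bdd_below B"
    and l: "0 < l" "l < 1"
    and sub: "\<And>x y. x \<in> A \<Longrightarrow> y \<in> B \<Longrightarrow> (1 - l) * x + l * y \<in> C"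
  shows "ennreal (1 - l) * emeasure lborel A + ennreal l * emeasure lborel B \<le> emeasure lborel C"
proof (rule ennreal_le_epsilon)
  fix e :: real assume e: "0 < e"
  note [measurable] = AB
  obtain a where a: "a \<in> A" "Sup A - e < a"
    using less_cSup_iff[OF \<open>A \<noteq> {}\<close> bdd(1), of "Sup A - e"] e by auto
  obtain b where b: "b \<in> B" "b < Inf B + e"
    using cInf_less_iff[OF \<open>B \<noteq> {}\<close> bdd(2), of "Inf B + e"] e by auto
  \<comment> \<open>\<open>p\<close> bounds the copy \<open>(1 - l) * A + l * b\<close> from above
    and \<open>q\<close> bounds \<open>(1 - l) * a + l * B\<close> from below. Both copies lie in
    \<open>C\<close>; as \<open>a\<close> and \<open>b\<close> are within \<open>e\<close> of the
    ends of their sets, the overlap has length at most \<open>e\<close>, so the two lengths add up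
    to within \<open>e\<close>.\<close>
  define p where "p = (1 - l) * Sup A + l * b"
  define q where "q = (1 - l) * a + l * Inf B"
  have "(1 - l) * (Sup A - a) \<le> (1 - l) * e" "l * (b - Inf B) \<le> l * e"
    using a b l by (auto intro!: mult_left_mono)
  then have pq: "p - q \<le> e" by (simp add: p_def q_def algebra_simps)
  have 1: "ennreal (1 - l) * emeasure lborel A \<le> emeasure lborel (C \<inter> {..p})"
  proof -
    have "indicator A x \<le> (indicator (C \<inter> {..p}) (l * b + (1 - l) * x) :: ennreal)" for x
      using sub[of x b] b(1) cSup_upper[OF _ bdd(1), of x] l
      by (auto simp: indicator_def p_def add.commute intro!: mult_left_mono)
    then have "ennreal (1 - l) * (\<integral>\<^sup>+x. indicator A x \<partial>lborel)
        \<le> ennreal (1 - l) * (\<integral>\<^sup>+x. indicator (C \<inter> {..p}) (l * b + (1 - l) * x) \<partial>lborel)"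
      by (intro mult_left_mono nn_integral_mono) auto
    also have "\<dots> = emeasure lborel (C \<inter> {..p})"
      using l nn_integral_real_affine[of "indicator (C \<inter> {..p})" "1 - l" "l * b"] by simp
    finally show ?thesis by simp
  qed
  have 2: "ennreal l * emeasure lborel B \<le> emeasure lborel (C \<inter> {q..})"
  proof -
    have "indicator B x \<le> (indicator (C \<inter> {q..}) ((1 - l) * a + l * x) :: ennreal)" for x
      using sub[of a x] a(1) cInf_lower[OF _ bdd(2), of x] l
      by (auto simp: indicator_def q_def intro!: mult_left_mono)
    then have "ennreal l * (\<integral>\<^sup>+x. indicator B x \<partial>lborel)
        \<le> ennreal l * (\<integral>\<^sup>+x. indicator (C \<inter> {q..}) ((1 - l) * a + l * x) \<partial>lborel)"
      by (intro mult_left_mono nn_integral_mono) auto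
    also have "\<dots> = emeasure lborel (C \<inter> {q..})"
      using l nn_integral_real_affine[of "indicator (C \<inter> {q..})" l "(1 - l) * a"] by simp
    finally show ?thesis by simp
  qed
  have "emeasure lborel (C \<inter> {..p}) + emeasure lborel (C \<inter> {q..}) =
    emeasure lborel ((C \<inter> {..p}) \<union> (C \<inter> {q..})) + emeasure lborel ((C \<inter> {..p}) \<inter> (C \<inter> {q..}))"
    by (rule emeasure_Un_Int) auto
  also have "\<dots> \<le> emeasure lborel C + emeasure lborel {q..p}"
    by (intro add_mono emeasure_mono) auto
  also have "emeasure lborel {q..p} \<le> ennreal e"
    using pq e by (cases "q \<le> p") (auto simp: ennreal_leI)
  finally show "ennreal (1 - l) * emeasure lborel A + ennreal l * emeasure lborel B \<le> emeasure lborel C + ennreal e"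
    using add_mono[OF 1 2] by (meson add_left_mono order_trans)
qed

text \<open>Layer-cake formula with levels written as \<open>a * t\<close>,
  \<open>0 < t < 1\<close>, so that functions with different suprema can be compared at a common
  \<open>t\<close>. Levels above \<open>a\<close> are not seen, hence the truncation; where only a
  lower bound of an integral is wanted, this costs nothing.\<close>

lemma nn_integral_layer_min:
  fixes F :: "real \<Rightarrow> real"
  assumes [measurable]: "F \<in> borel_measurable borel" and F: "\<And>x. 0 \<le> F x" and a: "0 < a"
  shows "ennreal a * (\<integral>\<^sup>+t. indicator {0<..<1} t * emeasure lborel {x. a * t < F x} \<partial>lborel)
     = (\<integral>\<^sup>+x. ennreal (min a (F x)) \<partial>lborel)"
proof -
  have "(\<integral>\<^sup>+t. indicator {0<..<1} t * emeasure lborel {x. a * t < F x} \<partial>lborel)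
     = (\<integral>\<^sup>+t. \<integral>\<^sup>+x. indicator {0<..<1} t * indicator {x. a * t < F x} x \<partial>lborel \<partial>lborel)"
    by (simp add: nn_integral_cmult)
  also have "\<dots> = (\<integral>\<^sup>+x. \<integral>\<^sup>+t. indicator {0<..<1} t * indicator {x. a * t < F x} x \<partial>lborel \<partial>lborel)"
    by (rule lborel_pair.Fubini') simp
  also have "\<dots> = (\<integral>\<^sup>+x. ennreal (min a (F x) / a) \<partial>lborel)"
  proof (rule nn_integral_cong)
    fix x
    have "(\<integral>\<^sup>+t. indicator {0<..<1} t * indicator {x. a * t < F x} x \<partial>lborel)
      = (\<integral>\<^sup>+t. indicator {0<..<min a (F x) / a} t \<partial>lborel)"
      using a by (intro nn_integral_cong) (auto simp: indicator_def field_simps)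
    then show "(\<integral>\<^sup>+t. indicator {0<..<1} t * indicator {x. a * t < F x} x \<partial>lborel) = ennreal (min a (F x) / a)"
      using a F[of x] by (simp add: nn_integral_indicator)
  qed
  finally show ?thesis
    using a F by (simp add: nn_integral_cmult[symmetric] ennreal_mult[symmetric] del: nn_integral_cmult)
qed

lemma integrable_lborel_bounded_support:
  fixes F :: "'a::euclidean_space \<Rightarrow> real"
  assumes [measurable]: "F \<in> borel_measurable borel" and "\<And>x. \<bar>F x\<bar> \<le> D" and "bounded S"
    and "\<And>x. x \<notin> S \<Longrightarrow> F x = 0"
  shows "integrable lborel F"
proof -
  obtain c d where "S \<subseteq> cbox c d" using bounded_subset_cbox_symmetric[OF \<open>bounded S\<close>] by blast
  have "integrable lborel (\<lambda>x. D * indicator (cbox c d) x :: real)"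
    by (intro integrable_mult_right integrable_real_indicator) (auto simp: emeasure_lborel_cbox_eq)
  then show ?thesis
  proof (rule Bochner_Integration.integrable_bound)
    show "AE x in lborel. norm (F x) \<le> norm (D * indicator (cbox c d) x)"
    proof (rule AE_I2)
      fix x show "norm (F x) \<le> norm (D * indicator (cbox c d) x)"
        using assms(2)[of x] assms(4)[of x] \<open>S \<subseteq> cbox c d\<close> by (cases "x \<in> cbox c d") auto
    qed
  qed simp
qed

text \<open>Levels are taken relative to the suprema \<open>a\<close> and \<open>b\<close>: then the
  level sets of \<open>F\<close> and \<open>G\<close> are nonempty for the same \<open>t\<close>, as
  the one-dimensional Brunn-Minkowski inequality requires. Integrating over \<open>t\<close> bounds
  the integral of \<open>H\<close> below by \<open>c\<close> times the arithmetic mean of the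
  normalised integrals, and weighted AM-GM passes to the geometric mean.\<close>

lemma prekopa_leindler_real:
  fixes F G H :: "real \<Rightarrow> real"
  assumes meas [measurable]: "F \<in> borel_measurable borel" "G \<in> borel_measurable borel" "H \<in> borel_measurable borel"
    and nonneg: "\<And>x. 0 \<le> F x" "\<And>x. 0 \<le> G x" "\<And>x. 0 \<le> H x"
    and bdd: "\<And>x. F x \<le> D" "\<And>x. G x \<le> D" "\<And>x. H x \<le> D"
    and supp: "\<And>x. x \<notin> {-R..R} \<Longrightarrow> F x = 0" "\<And>x. x \<notin> {-R..R} \<Longrightarrow> G x = 0" "\<And>x. x \<notin> {-R..R} \<Longrightarrow> H x = 0"
    and l: "0 < l" "l < 1"
    and mean: "\<And>x y. F x powr (1 - l) * G y powr l \<le> H ((1 - l) * x + l * y)"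
  shows "(\<integral>x. F x \<partial>lborel) powr (1 - l) * (\<integral>x. G x \<partial>lborel) powr l \<le> (\<integral>x. H x \<partial>lborel)"
proof (cases "(\<forall>x. F x = 0) \<or> (\<forall>x. G x = 0)")
  case True
  then have "(\<integral>x. F x \<partial>lborel) = 0 \<or> (\<integral>x. G x \<partial>lborel) = 0" by auto
  then show ?thesis using nonneg by auto
next
  case False
  have int: "integrable lborel F" "integrable lborel G" "integrable lborel H"
    using nonneg bdd supp by (auto intro!: integrable_lborel_bounded_support[where S="{-R..R}" and D=D])
  define a where "a = (SUP x. F x)"
  define b where "b = (SUP x. G x)"
  have bF: "bdd_above (range F)" and bG: "bdd_above (range G)" using bdd by (auto simp: bdd_above_def)
  have Fa: "F x \<le> a" for x unfolding a_def by (rule cSUP_upper[OF _ bF]) simp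
  have Gb: "G x \<le> b" for x unfolding b_def by (rule cSUP_upper[OF _ bG]) simp
  have a: "0 < a" using False Fa nonneg by (metis order_le_less order_trans order_antisym)
  have b: "0 < b" using False Gb nonneg by (metis order_le_less order_trans order_antisym)
  define c where "c = a powr (1 - l) * b powr l"
  have c: "0 < c" using a b by (simp add: c_def)
  let ?I = "indicator {0<..<1} :: real \<Rightarrow> ennreal"
  have level: "?I t * (ennreal (1 - l) * emeasure lborel {x. a * t < F x} + ennreal l * emeasure lborel {x. b * t < G x})
      \<le> ?I t * emeasure lborel {x. c * t < H x}" for t
  proof (cases "0 < t \<and> t < 1")
    case True
    have "a * t < a" "b * t < b" using True a b by simp_all
    then have ne: "{x. a * t < F x} \<noteq> {}" "{x. b * t < G x} \<noteq> {}"
      using less_cSUP_iff[OF _ bF, of "a * t"] less_cSUP_iff[OF _ bG, of "b * t"] by (auto simp: a_def b_def)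
    have at: "0 < a * t" "0 < b * t" using True a b by simp_all
    have "x \<in> {-R..R}" if "a * t < F x" for x using that at supp(1)[of x] by fastforce
    then have A: "bdd_above {x. a * t < F x}" by (auto simp: bdd_above_def)
    have "x \<in> {-R..R}" if "b * t < G x" for x using that at supp(2)[of x] by fastforce
    then have B: "bdd_below {x. b * t < G x}" by (auto simp: bdd_below_def)
    have "c * t < H ((1 - l) * x + l * y)" if "a * t < F x" "b * t < G y" for x y
    proof -
      \<comment> \<open>The exponents sum to 1, so the weighted geometric mean is homogeneous of
        degree one and the factor \<open>t\<close> comes out.\<close>
      have "c * t = (a * t) powr (1 - l) * (b * t) powr l"
        using True a b by (simp add: c_def powr_mult powr_diff)
      also have "\<dots> < F x powr (1 - l) * G y powr l"
        using that l at by (intro mult_strict_mono powr_less_mono2) auto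
      finally show ?thesis using mean[of x y] by simp
    qed
    then have "ennreal (1 - l) * emeasure lborel {x. a * t < F x} + ennreal l * emeasure lborel {x. b * t < G x}
      \<le> emeasure lborel {x. c * t < H x}"
      using ne A B l by (intro brunn_minkowski_real) auto
    then show ?thesis by (intro mult_left_mono) auto
  qed auto
  have lF: "ennreal a * (\<integral>\<^sup>+t. ?I t * emeasure lborel {x. a * t < F x} \<partial>lborel) = ennreal (\<integral>x. F x \<partial>lborel)"
    using nn_integral_layer_min[of F a] a Fa nonneg int by (simp add: min_absorb2 nn_integral_eq_integral)
  have lG: "ennreal b * (\<integral>\<^sup>+t. ?I t * emeasure lborel {x. b * t < G x} \<partial>lborel) = ennreal (\<integral>x. G x \<partial>lborel)"
    using nn_integral_layer_min[of G b] b Gb nonneg int by (simp add: min_absorb2 nn_integral_eq_integral)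
  have "ennreal c * (\<integral>\<^sup>+t. ?I t * emeasure lborel {x. c * t < H x} \<partial>lborel) = (\<integral>\<^sup>+x. ennreal (min c (H x)) \<partial>lborel)"
    using c nonneg by (simp add: nn_integral_layer_min)
  also have "\<dots> \<le> (\<integral>\<^sup>+x. ennreal (H x) \<partial>lborel)"
    by (intro nn_integral_mono ennreal_leI) auto
  finally have lH: "ennreal c * (\<integral>\<^sup>+t. ?I t * emeasure lborel {x. c * t < H x} \<partial>lborel) \<le> ennreal (\<integral>x. H x \<partial>lborel)"
    using int nonneg by (simp add: nn_integral_eq_integral)
  define f where "f = (\<integral>x. F x \<partial>lborel) / a"
  define g where "g = (\<integral>x. G x \<partial>lborel) / b"
  have fg: "0 \<le> f" "0 \<le> g" using nonneg a b by (auto simp: f_def g_def intro!: divide_nonneg_pos integral_nonneg_AE)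
  have ef: "(\<integral>\<^sup>+t. ?I t * emeasure lborel {x. a * t < F x} \<partial>lborel) = ennreal f"
  proof -
    have "ennreal a * (\<integral>\<^sup>+t. ?I t * emeasure lborel {x. a * t < F x} \<partial>lborel) = ennreal a * ennreal f"
      unfolding lF using a fg by (simp add: f_def ennreal_mult[symmetric])
    then show ?thesis using a by (simp add: ennreal_mult_cancel_left)
  qed
  have eg: "(\<integral>\<^sup>+t. ?I t * emeasure lborel {x. b * t < G x} \<partial>lborel) = ennreal g"
  proof -
    have "ennreal b * (\<integral>\<^sup>+t. ?I t * emeasure lborel {x. b * t < G x} \<partial>lborel) = ennreal b * ennreal g"
      unfolding lG using b fg by (simp add: g_def ennreal_mult[symmetric])
    then show ?thesis using b by (simp add: ennreal_mult_cancel_left)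
  qed
  have "ennreal (1 - l) * ennreal f + ennreal l * ennreal g
    = (\<integral>\<^sup>+t. ?I t * (ennreal (1 - l) * emeasure lborel {x. a * t < F x} + ennreal l * emeasure lborel {x. b * t < G x}) \<partial>lborel)"
    unfolding ef[symmetric] eg[symmetric]
    by (simp add: nn_integral_add[symmetric] nn_integral_cmult[symmetric] distrib_left mult.left_commute del: nn_integral_cmult)
  also have "\<dots> \<le> (\<integral>\<^sup>+t. ?I t * emeasure lborel {x. c * t < H x} \<partial>lborel)"
    by (intro nn_integral_mono level)
  finally have "ennreal c * (ennreal (1 - l) * ennreal f + ennreal l * ennreal g) \<le> ennreal (\<integral>x. H x \<partial>lborel)"
    using lH by (meson mult_left_mono order_trans zero_le)
  then have "ennreal (c * ((1 - l) * f + l * g)) \<le> ennreal (\<integral>x. H x \<partial>lborel)"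
    using l fg c by (simp add: ennreal_mult ennreal_plus)
  then have "c * ((1 - l) * f + l * g) \<le> (\<integral>x. H x \<partial>lborel)"
    using nonneg by (simp add: ennreal_le_iff integral_nonneg_AE)
  moreover have "f powr (1 - l) * g powr l \<le> (1 - l) * f + l * g"
  proof (cases "f = 0 \<or> g = 0")
    case True then show ?thesis using fg l by auto
  next
    case False then show ?thesis using fg l by (intro Youngs_inequality_0) auto
  qed
  ultimately have "c * (f powr (1 - l) * g powr l) \<le> (\<integral>x. H x \<partial>lborel)"
    using c by (meson mult_left_mono order_trans less_imp_le)
  moreover have "a * f = (\<integral>x. F x \<partial>lborel)" "b * g = (\<integral>x. G x \<partial>lborel)" using a b by (auto simp: f_def g_def)
  ultimately show ?thesis
    using a b fg by (simp add: c_def mult_ac flip: powr_mult) (metis (no_types, lifting) mult.assoc powr_mult)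
qed

section \<open>Slicing and Brunn-Minkowski for the product measure\<close>

interpretation lborel_nat: product_sigma_finite "\<lambda>_::nat. lborel :: real measure"
  by standard

lemma space_lebn [simp]: "space (lebn n) = Rn n"
  by (simp add: lebn_def Rn_def space_PiM)

lemma sigma_finite_lebn: "sigma_finite_measure (lebn n)"
  unfolding lebn_def by (rule lborel_nat.sigma_finite) simp

lemma measurable_lebn_component [measurable]: "i < n \<Longrightarrow> (\<lambda>x. x i) \<in> borel_measurable (lebn n)"
  unfolding lebn_def by measurable

lemma measurable_lebnI:
  assumes "\<And>i. i < n \<Longrightarrow> (\<lambda>x. f x i) \<in> borel_measurable M" and "f \<in> space M \<rightarrow> Rn n"
  shows "f \<in> measurable M (lebn n)"
  unfolding lebn_def using assms by (intro measurable_PiM_single') (auto simp: Rn_def)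

lemma Rn_upd: "y \<in> Rn m \<Longrightarrow> y(m := z) \<in> Rn (Suc m)"
  by (auto simp: Rn_def PiE_def extensional_def)

lemma measurable_lebn_upd [measurable]:
  "(\<lambda>p. (fst p)(m := snd p)) \<in> measurable (lebn m \<Otimes>\<^sub>M lborel) (lebn (Suc m))"
proof (rule measurable_lebnI)
  fix i assume "i < Suc m"
  then show "(\<lambda>x. ((fst x)(m := snd x)) i) \<in> borel_measurable (lebn m \<Otimes>\<^sub>M lborel)"
    by (cases "i = m") (auto intro: measurable_compose[OF measurable_fst measurable_lebn_component])
qed (auto simp: space_pair_measure Rn_upd)

lemma nn_integral_lebn_Suc:
  assumes "f \<in> borel_measurable (lebn (Suc m))"
  shows "(\<integral>\<^sup>+x. f x \<partial>lebn (Suc m)) = (\<integral>\<^sup>+z. \<integral>\<^sup>+y. f (y(m := z)) \<partial>lebn m \<partial>lborel)"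
  using assms lborel_nat.product_nn_integral_insert_rev[of "{..<m}" m f]
  by (simp add: lebn_def lessThan_Suc)

text \<open>The slice fixes the last coordinate, so that the index set remains an initial segment
  and one function update leads from \<open>Rn m\<close> to \<open>Rn (Suc m)\<close>.\<close>

definition sec :: "nat \<Rightarrow> (nat \<Rightarrow> real) set \<Rightarrow> real \<Rightarrow> (nat \<Rightarrow> real) set" where
  "sec m A z = {y \<in> Rn m. y(m := z) \<in> A}"

lemma sets_sec [measurable]:
  assumes [measurable]: "A \<in> sets (lebn (Suc m))"
  shows "sec m A z \<in> sets (lebn m)"
proof -
  have "(\<lambda>y. y(m := z)) \<in> measurable (lebn m) (lebn (Suc m))"
    using measurable_compose[OF measurable_Pair2' measurable_lebn_upd[of m], of z] by simp
  from measurable_sets[OF this assms] show ?thesis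
    by (simp add: sec_def vimage_def Int_def conj_commute)
qed

lemma measurable_emeasure_sec [measurable]:
  assumes [measurable]: "A \<in> sets (lebn (Suc m))"
  shows "(\<lambda>z. emeasure (lebn m) (sec m A z)) \<in> borel_measurable borel"
proof -
  interpret sigma_finite_measure "lebn m" by (rule sigma_finite_lebn)
  have [measurable]: "(\<lambda>p. (snd p)(m := fst p)) \<in> measurable (lborel \<Otimes>\<^sub>M lebn m) (lebn (Suc m))"
    using measurable_compose[OF measurable_pair_swap' measurable_lebn_upd[of m]] by (simp add: case_prod_beta)
  have "(\<lambda>z. \<integral>\<^sup>+y. indicator A (y(m := z)) \<partial>lebn m) \<in> borel_measurable lborel"
    by (intro borel_measurable_nn_integral)
       (simp add: case_prod_beta)
  moreover have "(\<integral>\<^sup>+y. indicator A (y(m := z)) \<partial>lebn m) = emeasure (lebn m) (sec m A z)" for z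
    by (subst nn_integral_indicator[symmetric], simp)
       (auto intro!: nn_integral_cong simp: sec_def indicator_def)
  ultimately show ?thesis by simp
qed

lemma emeasure_lebn_Suc:
  assumes [measurable]: "A \<in> sets (lebn (Suc m))"
  shows "emeasure (lebn (Suc m)) A = (\<integral>\<^sup>+z. emeasure (lebn m) (sec m A z) \<partial>lborel)"
proof -
  have "emeasure (lebn (Suc m)) A = (\<integral>\<^sup>+z. \<integral>\<^sup>+y. indicator A (y(m := z)) \<partial>lebn m \<partial>lborel)"
    by (subst nn_integral_lebn_Suc[symmetric]) auto
  also have "\<dots> = (\<integral>\<^sup>+z. emeasure (lebn m) (sec m A z) \<partial>lborel)"
    by (intro nn_integral_cong, subst nn_integral_indicator[symmetric], simp)
       (auto intro!: nn_integral_cong simp: sec_def indicator_def)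
  finally show ?thesis .
qed

text \<open>A common bounding box. Slices of a subset stay in the cube with the same
  \<open>R\<close> one dimension lower and are empty outside \<open>{-R..R}\<close>, which supplies
  the bounds and supports that the real-valued Prekopa-Leindler inequality asks for.\<close>

definition cube :: "nat \<Rightarrow> real \<Rightarrow> (nat \<Rightarrow> real) set" where
  "cube n R = PiE {..<n} (\<lambda>_. {-R..R})"

lemma cube_iff: "x \<in> cube n R \<longleftrightarrow> x \<in> Rn n \<and> (\<forall>i<n. \<bar>x i\<bar> \<le> R)"
  unfolding cube_def Rn_def by (auto simp: PiE_iff abs_le_iff minus_le_iff)

lemma sets_cube [measurable]: "cube n R \<in> sets (lebn n)"
  unfolding cube_def lebn_def by (intro sets_PiM_I_finite) auto

lemma emeasure_cube: "0 \<le> R \<Longrightarrow> emeasure (lebn n) (cube n R) = ennreal ((2 * R) ^ n)"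
  unfolding cube_def lebn_def
  by (subst lborel_nat.emeasure_PiM) (auto simp: ennreal_power)

lemma sec_cube: "A \<subseteq> cube (Suc m) R \<Longrightarrow> sec m A z \<subseteq> cube m R"
proof
  fix y assume A: "A \<subseteq> cube (Suc m) R" and y: "y \<in> sec m A z"
  then have "y(m := z) \<in> cube (Suc m) R" by (auto simp: sec_def)
  then have "\<bar>y i\<bar> \<le> R" if "i < m" for i using that by (auto simp: cube_iff dest!: spec[of _ i])
  then show "y \<in> cube m R" using y by (auto simp: cube_iff sec_def)
qed

lemma sec_empty:
  assumes A: "A \<subseteq> cube (Suc m) R" and z: "z \<notin> {-R..R}"
  shows "sec m A z = {}"
proof (rule ccontr)
  assume "sec m A z \<noteq> {}"
  then obtain y where "y(m := z) \<in> cube (Suc m) R" using A by (auto simp: sec_def)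
  then have "\<bar>z\<bar> \<le> R" by (auto simp: cube_iff dest!: spec[of _ m])
  then show False using z by auto
qed

lemma emeasure_subset_cube:
  assumes "A \<subseteq> cube n R" "0 \<le> R"
  shows "emeasure (lebn n) A = ennreal (measure (lebn n) A)" "measure (lebn n) A \<le> (2 * R) ^ n"
proof -
  have *: "emeasure (lebn n) A \<le> ennreal ((2 * R) ^ n)"
    using emeasure_mono[OF assms(1) sets_cube] emeasure_cube[OF assms(2)] by metis
  then have fin: "emeasure (lebn n) A \<noteq> \<infinity>" by (auto simp: top_unique)
  then show 1: "emeasure (lebn n) A = ennreal (measure (lebn n) A)"
    by (simp add: emeasure_eq_ennreal_measure)
  show "measure (lebn n) A \<le> (2 * R) ^ n"
    using * assms(2) unfolding 1 by (simp add: ennreal_le_iff)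
qed

lemma measurable_measure_sec [measurable]:
  assumes [measurable]: "A \<in> sets (lebn (Suc m))"
  shows "(\<lambda>z. measure (lebn m) (sec m A z)) \<in> borel_measurable borel"
  unfolding measure_def by measurable

lemma measure_lebn_Suc:
  assumes [measurable]: "A \<in> sets (lebn (Suc m))" and A: "A \<subseteq> cube (Suc m) R" "0 \<le> R"
  shows "integrable lborel (\<lambda>z. measure (lebn m) (sec m A z))"
    and "measure (lebn (Suc m)) A = (\<integral>z. measure (lebn m) (sec m A z) \<partial>lborel)"
proof -
  show int: "integrable lborel (\<lambda>z. measure (lebn m) (sec m A z))"
    using emeasure_subset_cube(2)[OF sec_cube[OF A(1)] A(2)] sec_empty[OF A(1)]
    by (intro integrable_lborel_bounded_support[where D="(2 * R) ^ m" and S="{-R..R}"]) auto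
  have "ennreal (measure (lebn (Suc m)) A) = (\<integral>\<^sup>+z. ennreal (measure (lebn m) (sec m A z)) \<partial>lborel)"
    unfolding emeasure_subset_cube(1)[OF A, symmetric]
      emeasure_subset_cube(1)[OF sec_cube[OF A(1)] A(2), symmetric]
    by (rule emeasure_lebn_Suc) fact
  also have "\<dots> = ennreal (\<integral>z. measure (lebn m) (sec m A z) \<partial>lborel)"
    using int by (intro nn_integral_eq_integral) auto
  finally show "measure (lebn (Suc m)) A = (\<integral>z. measure (lebn m) (sec m A z) \<partial>lborel)"
    by (simp add: integral_nonneg_AE)
qed

text \<open>The convex combination occurring in \<open>convex_n\<close>, named so that it can be
  pushed through slices and through \<open>embed\<close>.\<close>

definition mix :: "nat \<Rightarrow> real \<Rightarrow> (nat \<Rightarrow> real) \<Rightarrow> (nat \<Rightarrow> real) \<Rightarrow> (nat \<Rightarrow> real)" where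
  "mix n t x y = (\<lambda>i. if i < n then (1 - t) * x i + t * y i else undefined)"

lemma mix_Suc: "mix (Suc m) t (x(m := a)) (y(m := b)) = (mix m t x y)(m := (1 - t) * a + t * b)"
  by (auto simp: mix_def fun_eq_iff)

lemma mix_Rn: "mix n t x y \<in> Rn n"
  by (auto simp: mix_def Rn_def PiE_iff extensional_def)

text \<open>Slicing by the last coordinate reduces the inequality to its one-dimensional functional form.\<close>
lemma brunn_minkowski_lebn:
  assumes l: "0 < l" "l < 1" and R: "0 \<le> R"
  shows "\<lbrakk>A \<in> sets (lebn m); B \<in> sets (lebn m); C \<in> sets (lebn m);
      A \<subseteq> cube m R; B \<subseteq> cube m R; C \<subseteq> cube m R;
      \<And>x y. x \<in> A \<Longrightarrow> y \<in> B \<Longrightarrow> mix m l x y \<in> C\<rbrakk>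
    \<Longrightarrow> measure (lebn m) A powr (1 - l) * measure (lebn m) B powr l \<le> measure (lebn m) C"
proof (induction m arbitrary: A B C)
  case 0
  \<comment> \<open>Dimension zero is a single point of mass 1. An empty \<open>A\<close> or
    \<open>B\<close> makes the left-hand side vanish, since \<open>0 powr x = 0\<close>.\<close>
  have "A = {} \<or> A = {\<lambda>_. undefined}" "B = {} \<or> B = {\<lambda>_. undefined}"  "C = {} \<or> C = {\<lambda>_. undefined}"
    using "0.prems"(4-6) by (auto simp: cube_def)
  moreover have "measure (lebn 0) {\<lambda>_. undefined} = 1"
    by (simp add: lebn_def PiM_empty measure_def)
  ultimately show ?case using "0.prems"(7)[of "\<lambda>_. undefined" "\<lambda>_. undefined"] by auto
next
  case (Suc m)
  note [measurable] = Suc.prems(1-3)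
  note sub = Suc.prems(4-6)
  show ?case
    unfolding measure_lebn_Suc(2)[OF Suc.prems(1) sub(1) R] measure_lebn_Suc(2)[OF Suc.prems(2) sub(2) R]
      measure_lebn_Suc(2)[OF Suc.prems(3) sub(3) R]
  proof (rule prekopa_leindler_real[where D="(2 * R) ^ m" and R=R])
    fix x y :: real
    show "measure (lebn m) (sec m A x) powr (1 - l) * measure (lebn m) (sec m B y) powr l
       \<le> measure (lebn m) (sec m C ((1 - l) * x + l * y))"
    proof (rule Suc.IH)
      fix a b assume "a \<in> sec m A x" "b \<in> sec m B y"
      then show "mix m l a b \<in> sec m C ((1 - l) * x + l * y)"
        using Suc.prems(7)[of "a(m := x)" "b(m := y)"] by (simp add: sec_def mix_Suc mix_Rn del: fun_upd_apply)
    qed (use sub[THEN sec_cube] in auto)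
  qed (use l in \<open>auto simp: sub[THEN sec_empty] intro!: sub[THEN sec_cube, THEN emeasure_subset_cube(2), OF R, simplified]\<close>)
qed

section \<open>Log-concave functions and their barycentre\<close>

text \<open>Halving towards \<open>a\<close> has Jacobian \<open>(1/2) ^ DIM('a)\<close>. This is
  the only place where a numerical constant enters through a change of variables.\<close>

lemma integral_lborel_midpoint:
  fixes f :: "'a::euclidean_space \<Rightarrow> real"
  assumes f: "integrable lborel f"
  shows "integrable lborel (\<lambda>p. f ((1/2) *\<^sub>R a + (1/2) *\<^sub>R p))"
    and "(\<integral>p. f ((1/2) *\<^sub>R a + (1/2) *\<^sub>R p) \<partial>lborel) = 2 ^ DIM('a) * (\<integral>p. f p \<partial>lborel)"
proof -
  let ?T = "\<lambda>p::'a. (1/2) *\<^sub>R a + (1/2) *\<^sub>R p"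
  have lb: "lborel = density (distr lborel borel ?T) (\<lambda>_. ennreal ((1/2) ^ DIM('a)))"
    using lborel_affine[of "1/2" "(1/2) *\<^sub>R a"] by simp
  have [measurable]: "f \<in> borel_measurable borel" using f by auto
  have "integrable (density (distr lborel borel ?T) (\<lambda>_. ennreal ((1/2) ^ DIM('a)))) f"
    using f lb by simp
  then show "integrable lborel (\<lambda>p. f (?T p))"
    by (subst (asm) integrable_density) (auto simp: integrable_distr_eq)
  have "(\<integral>p. f p \<partial>lborel) = (\<integral>p. f p \<partial>density (distr lborel borel ?T) (\<lambda>_. ennreal ((1/2) ^ DIM('a))))"
    using lb by simp
  also have "\<dots> = (1/2) ^ DIM('a) * (\<integral>p. f (?T p) \<partial>lborel)"
    by (subst integral_density) (auto simp: integral_distr)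
  finally show "(\<integral>p. f (?T p) \<partial>lborel) = 2 ^ DIM('a) * (\<integral>p. f p \<partial>lborel)"
    by (simp add: power_one_over field_simps)
qed

text \<open>Hyperplanes are null sets; this excludes a vertical supporting hyperplane in the proof
  of Jensen's inequality.\<close>

lemma AE_lborel_inner_nonzero:
  fixes a :: "'a::euclidean_space"
  assumes "a \<noteq> 0"
  shows "AE x in lborel. a \<bullet> x \<noteq> 0"
proof -
  have "negligible {x. a \<bullet> x = 0}" using assms by (intro negligible_hyperplane) auto
  moreover have "{x. a \<bullet> x = 0} \<in> sets borel" by measurable
  ultimately have "{x. a \<bullet> x = 0} \<in> null_sets lborel"
    by (simp add: negligible_iff_null_sets null_sets_completion_iff)
  then show ?thesis by (rule AE_I') auto
qed

text \<open>With \<open>s = sqrt r\<close> this is \<open>1 - ln s <= 1 / s\<close> multiplied by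
  \<open>s * s\<close>. It trades entropy for a square root, which log-concavity controls at
  midpoints.\<close>

lemma entropy_le_sqrt:
  fixes r :: real
  assumes "0 \<le> r"
  shows "r - r * ln r / 2 \<le> sqrt r"
proof (cases "r = 0")
  case False
  define s where "s = sqrt r"
  have s: "0 < s" "r = s * s" using False assms by (auto simp: s_def)
  have "ln (1 / s) \<le> 1 / s - 1" using s by (intro ln_le_minus_one) auto
  then have "1 - ln s \<le> 1 / s" using s by (simp add: ln_div)
  then have "s * s * (1 - ln s) \<le> s * s * (1 / s)" using s by (intro mult_left_mono) auto
  moreover have "ln r = 2 * ln s" using s by (simp add: ln_mult)
  ultimately show ?thesis using s by (simp add: s_def[symmetric] algebra_simps)
qed simp

text \<open>Serves the integrability of the entropy: \<open>ln (1 / r) <= 1 / r - 1\<close> bounds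
  \<open>r * ln r\<close> below by \<open>-1\<close>, and \<open>ln r <= r - 1\<close> bounds it
  above by \<open>D * D\<close>.\<close>

lemma abs_mult_ln_le:
  fixes r :: real
  assumes "0 \<le> r" "r \<le> D"
  shows "\<bar>r * ln r\<bar> \<le> 1 + D * D"
proof (cases "r = 0")
  case False
  then have r: "0 < r" using assms by simp
  have "ln (1 / r) \<le> 1 / r - 1" using r by (intro ln_le_minus_one) auto
  then have "r * - ln r \<le> r * (1 / r - 1)" using r by (intro mult_left_mono) (auto simp: ln_div)
  then have 1: "- (r * ln r) \<le> 1" using r by (simp add: algebra_simps)
  have "r * ln r \<le> r * (r - 1)" using r by (intro mult_left_mono ln_le_minus_one) auto
  also have "\<dots> \<le> D * D" using r assms mult_mono[of r D r D] by (simp add: algebra_simps)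
  finally show ?thesis using 1 zero_le_square[of D] by linarith
qed (use assms in simp)

text \<open>Jensen's inequality enters through a supporting hyperplane of the hypograph of \<open>ln f\<close> over \<open>0\<close>;
  as \<open>f 0 > 0\<close> is not known beforehand, its height \<open>L\<close> is arbitrary when \<open>f 0 = 0\<close>.\<close>
lemma log_concave_barycentre_bound:
  fixes f :: "'a::euclidean_space \<Rightarrow> real"
  assumes [measurable]: "f \<in> borel_measurable borel"
    and nonneg: "\<And>p. 0 \<le> f p" and bdd: "\<And>p. f p \<le> D"
    and supp: "bounded S" "\<And>p. p \<notin> S \<Longrightarrow> f p = 0"
    and lc: "\<And>p q l. 0 < l \<Longrightarrow> l < 1 \<Longrightarrow> f p powr (1 - l) * f q powr l \<le> f ((1 - l) *\<^sub>R p + l *\<^sub>R q)"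
    and cent: "\<And>a. (\<integral>p. (a \<bullet> p) * f p \<partial>lborel) = 0"
    and pos: "0 < (\<integral>p. f p \<partial>lborel)"
  shows "f z \<le> exp (2 * (2 ^ DIM('a) - 1)) * f 0"
proof (cases "f z = 0")
  case False
  define k :: real where "k = 2 * (2 ^ DIM('a) - 1)"
  have fz: "0 < f z" using False nonneg[of z] by simp
  \<comment> \<open>Normalised to \<open>r z = 1\<close>, so that the geometric mean of
    \<open>r z\<close> and \<open>r p\<close> is \<open>sqrt (r p)\<close> and the goal becomes
    \<open>exp (- k) <= r 0\<close>.\<close>
  define r where "r p = f p / f z" for p
  have [measurable]: "r \<in> borel_measurable borel" unfolding r_def[abs_def] by measurable
  have r0: "0 \<le> r p" for p using nonneg fz by (simp add: r_def)
  have rD: "r p \<le> D / f z" for p using bdd fz by (simp add: r_def divide_right_mono)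
  have rS: "p \<notin> S \<Longrightarrow> r p = 0" for p using supp(2) by (simp add: r_def)
  have int_r: "integrable lborel r"
    by (rule integrable_lborel_bounded_support[where D="D / f z" and S=S]) (use r0 rD rS supp in auto)
  have int_rl: "integrable lborel (\<lambda>p. r p * ln (r p))"
    by (rule integrable_lborel_bounded_support[where D="1 + (D / f z) * (D / f z)" and S=S])
       (use abs_mult_ln_le[OF r0 rD] rS supp in auto)
  have int_ra: "integrable lborel (\<lambda>p. (a \<bullet> p) * r p)" for a
  proof -
    obtain B where B: "\<And>p. p \<in> S \<Longrightarrow> norm p \<le> B" using supp(1) by (auto simp: bounded_iff)
    show ?thesis
    proof (rule integrable_lborel_bounded_support[where D="norm a * \<bar>B\<bar> * (D / f z)" and S=S])
      fix p show "\<bar>(a \<bullet> p) * r p\<bar> \<le> norm a * \<bar>B\<bar> * (D / f z)"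
      proof (cases "p \<in> S")
        case True
        have "\<bar>a \<bullet> p\<bar> \<le> norm a * \<bar>B\<bar>"
          using Cauchy_Schwarz_ineq2[of a p] B[OF True] mult_left_mono[of "norm p" "\<bar>B\<bar>" "norm a"]
          abs_ge_self[of B] norm_ge_zero[of a] by linarith
        then show ?thesis using r0[of p] rD[of p] unfolding abs_mult by (intro mult_mono) auto
      next
        case False
        moreover have "0 \<le> D" using nonneg[of p] bdd[of p] by linarith
        ultimately show ?thesis using fz rS by auto
      qed
    qed (use rS supp in auto)
  qed
  have rpos: "0 < (\<integral>p. r p \<partial>lborel)" using pos fz by (simp add: r_def)
  have rcent: "(\<integral>p. (a \<bullet> p) * r p \<partial>lborel) = 0" for a
    using cent[of a] by (simp add: r_def)
  have rlc: "r p powr (1 - l) * r q powr l \<le> r ((1 - l) *\<^sub>R p + l *\<^sub>R q)" if "0 < l" "l < 1" for p q l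
  proof -
    have "r p powr (1 - l) * r q powr l = f p powr (1 - l) * f q powr l / f z"
      using fz nonneg that by (simp add: r_def powr_divide powr_diff)
    also have "\<dots> \<le> f ((1 - l) *\<^sub>R p + l *\<^sub>R q) / f z" using lc[OF that] fz by (intro divide_right_mono) auto
    finally show ?thesis by (simp add: r_def)
  qed
  have "(\<integral>p. r p - r p * ln (r p) / 2 \<partial>lborel) \<le> (\<integral>p. r ((1/2) *\<^sub>R z + (1/2) *\<^sub>R p) \<partial>lborel)"
  proof (rule integral_mono)
    fix p
    have "sqrt (r p) \<le> r ((1/2) *\<^sub>R z + (1/2) *\<^sub>R p)"
      using rlc[of "1/2" z p] fz r0 by (simp add: r_def[of z] powr_half_sqrt)
    then show "r p - r p * ln (r p) / 2 \<le> r ((1/2) *\<^sub>R z + (1/2) *\<^sub>R p)"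
      using entropy_le_sqrt[OF r0[of p]] by linarith
  qed (use int_r int_rl integral_lborel_midpoint(1)[OF int_r] in auto)
  also have "\<dots> = 2 ^ DIM('a) * (\<integral>p. r p \<partial>lborel)"
    by (rule integral_lborel_midpoint(2)[OF int_r])
  finally have ent: "- k * (\<integral>p. r p \<partial>lborel) \<le> (\<integral>p. r p * ln (r p) \<partial>lborel)"
    using int_r int_rl by (simp add: k_def algebra_simps)
  have key: "- k \<le> L" if L: "0 < r 0 \<Longrightarrow> ln (r 0) \<le> L" for L
  proof -
    \<comment> \<open>The strict hypograph, restricted to points where \<open>r\<close> is positive
      because the value of \<open>ln\<close> at \<open>0\<close> carries no meaning. Separating two
      disjoint convex sets needs neither closedness nor an interior point.\<close>
    let ?H = "{(x, y). 0 < r x \<and> y < ln (r x)}"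
    have conv: "convex ?H"
      unfolding convex_alt
    proof (clarsimp, intro conjI)
      fix x y x' y' and u :: real
      assume *: "0 < r x" "y < ln (r x)" "0 < r x'" "y' < ln (r x')" "0 \<le> u" "u \<le> 1"
      have "0 < r ((1 - u) *\<^sub>R x + u *\<^sub>R x') \<and> (1 - u) * y + u * y' < ln (r ((1 - u) *\<^sub>R x + u *\<^sub>R x'))"
      proof (cases "u = 0 \<or> u = 1")
        case True then show ?thesis using * by auto
      next
        case False
        then have u: "0 < u" "u < 1" using * by auto
        have p: "0 < r x powr (1 - u) * r x' powr u" using * by simp
        then have p': "0 < r ((1 - u) *\<^sub>R x + u *\<^sub>R x')" using rlc[OF u, of x x'] by linarith
        have "(1 - u) * y + u * y' < (1 - u) * ln (r x) + u * ln (r x')"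
          using * u by (intro add_strict_mono mult_strict_left_mono) auto
        also have "\<dots> = ln (r x powr (1 - u) * r x' powr u)" using * by (simp add: ln_mult ln_powr)
        also have "\<dots> \<le> ln (r ((1 - u) *\<^sub>R x + u *\<^sub>R x'))" using rlc[OF u, of x x'] p p' by simp
        finally show ?thesis using p' by simp
      qed
      then show "0 < r ((1 - u) *\<^sub>R x + u *\<^sub>R x')" "(1 - u) * y + u * y' < ln (r ((1 - u) *\<^sub>R x + u *\<^sub>R x'))" by auto
    qed
    have rz: "r z = 1" using fz by (simp add: r_def)
    then have "(z, -1) \<in> ?H" by simp
    then have ne: "?H \<noteq> {}" by blast
    have disj: "?H \<inter> {(0, L)} = {}" using L by auto
    obtain ab c where ab: "ab \<noteq> 0" "\<forall>x\<in>?H. ab \<bullet> x \<le> c" "\<forall>x\<in>{(0, L)}. c \<le> ab \<bullet> x"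
      using separating_hyperplane_sets[OF conv convex_singleton ne insert_not_empty disj] by blast
    obtain a b where [simp]: "ab = (a, b)" by (cases ab)
    have H: "a \<bullet> x + b * y \<le> b * L" if "0 < r x" "y < ln (r x)" for x y
      using ab(2)[rule_format, of "(x, y)"] ab(3) that by (auto simp: inner_prod_def)
    have b0: "0 \<le> b"
    proof (rule ccontr)
      assume "\<not> 0 \<le> b"
      then have b: "b < 0" by simp
      \<comment> \<open>A height far down over \<open>z\<close>: \<open>y < 0 = ln (r z)\<close>,
        while for \<open>b < 0\<close> the product \<open>b * y\<close> exceeds
        \<open>\<bar>b * L - a \<bullet> z\<bar>\<close>, contradicting \<open>H\<close>.\<close>
      define y where "y = - 1 - \<bar>b * L - a \<bullet> z\<bar> / - b"
      have "y < ln (r z)" using b by (simp add: y_def rz)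
      then have "a \<bullet> z + b * y \<le> b * L" using H[of z y] rz by simp
      moreover have "b * y = - b + \<bar>b * L - a \<bullet> z\<bar>" using b by (simp add: y_def field_simps)
      ultimately show False using b by linarith
    qed
    have H2: "(a \<bullet> x) * r x + b * (r x * ln (r x)) \<le> b * L * r x" for x
    proof (cases "r x = 0")
      case False
      then have rx: "0 < r x" using r0[of x] by simp
      have "a \<bullet> x + b * ln (r x) \<le> b * L"
      proof (rule field_le_epsilon)
        fix e :: real assume e: "0 < e"
        \<comment> \<open>\<open>H\<close> covers only heights strictly below the graph, which is
          approached by a step of \<open>e / (b + 1)\<close>; the \<open>+ 1\<close> keeps the step
          defined for \<open>b = 0\<close>.\<close>
        have "a \<bullet> x + b * (ln (r x) - e / (b + 1)) \<le> b * L" using H[OF rx, of "ln (r x) - e / (b + 1)"] b0 e by simp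
        moreover have "b * (e / (b + 1)) \<le> e" using b0 e by (simp add: field_simps)
        ultimately show "a \<bullet> x + b * ln (r x) \<le> b * L + e" by (simp add: right_diff_distrib)
      qed
      from mult_right_mono[OF this, of "r x"] rx show ?thesis by (simp add: algebra_simps)
    qed simp
    \<comment> \<open>Integration of the supporting inequality against \<open>r\<close> is Jensen's
      inequality; the linear term drops out because the barycentre is the origin.\<close>
    have "(\<integral>x. (a \<bullet> x) * r x + b * (r x * ln (r x)) \<partial>lborel) \<le> (\<integral>x. b * L * r x \<partial>lborel)"
      by (rule integral_mono[OF _ _ H2]) (use int_r int_rl int_ra in auto)
    then have H3: "b * (\<integral>x. r x * ln (r x) \<partial>lborel) \<le> b * (L * (\<integral>x. r x \<partial>lborel))"
      using int_r int_rl int_ra rcent by simp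
    show ?thesis
    proof (cases "b = 0")
      case False
      then have "(\<integral>x. r x * ln (r x) \<partial>lborel) \<le> L * (\<integral>x. r x \<partial>lborel)" using H3 b0 by simp
      then have "- k * (\<integral>p. r p \<partial>lborel) \<le> L * (\<integral>x. r x \<partial>lborel)" using ent by linarith
      then show ?thesis using rpos mult_le_cancel_right_pos by blast
    next
      case True
      \<comment> \<open>The vertical case: \<open>(a \<bullet> x) * r x\<close> is nonpositive with
        integral zero, so \<open>r\<close> vanishes almost everywhere, against its positive
        mass.\<close>
      then have a: "a \<noteq> 0" using ab(1) by (auto simp: zero_prod_def)
      have le: "0 \<le> - ((a \<bullet> x) * r x)" for x using H2[of x] True by simp
      have "(\<integral>x. - ((a \<bullet> x) * r x) \<partial>lborel) = 0" using rcent by simp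
      then have "AE x in lborel. - ((a \<bullet> x) * r x) = 0"
        using integral_nonneg_eq_0_iff_AE[of lborel "\<lambda>x. - ((a \<bullet> x) * r x)"] int_ra[of a] le by auto
      with AE_lborel_inner_nonzero[OF a] have "AE x in lborel. r x = 0" by eventually_elim auto
      then have "(\<integral>x. r x \<partial>lborel) = 0" by (simp add: integral_eq_zero_AE)
      then show ?thesis using rpos by simp
    qed
  qed
  \<comment> \<open>If \<open>r 0\<close> were \<open>0\<close>, the choice
    \<open>L = - k - 1\<close> would be admissible in \<open>key\<close> and contradict it.\<close>
  have "0 < r 0" using key[of "- k - 1"] r0[of 0] by force
  moreover from this key[of "ln (r 0)"] have "exp (- k) \<le> r 0" by (simp add: ln_ge_iff)
  ultimately show ?thesis
    unfolding k_def[symmetric] using fz by (simp add: r_def exp_minus field_simps)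
qed (use nonneg in simp)

lemma log_concave_axis_product_bound:
  fixes f :: "real \<times> real \<Rightarrow> real"
  assumes [measurable]: "f \<in> borel_measurable borel"
    and nonneg: "\<And>p. 0 \<le> f p" and bdd: "\<And>p. f p \<le> D"
    and supp: "bounded S" "\<And>p. p \<notin> S \<Longrightarrow> f p = 0"
    and lc: "\<And>p q l. 0 < l \<Longrightarrow> l < 1 \<Longrightarrow> f p powr (1 - l) * f q powr l \<le> f ((1 - l) *\<^sub>R p + l *\<^sub>R q)"
    and cent: "(\<integral>p. fst p * f p \<partial>lborel) = 0" "(\<integral>p. snd p * f p \<partial>lborel) = 0"
    and pos: "0 < (\<integral>p. f p \<partial>lborel)"
  shows "(\<integral>t. f (t, 0) \<partial>lborel) * (\<integral>s. f (0, s) \<partial>lborel) \<le> 4 * exp 6 * f (0, 0) * (\<integral>p. f p \<partial>lborel)"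
proof -
  have int_f: "integrable lborel f"
    by (rule integrable_lborel_bounded_support[where D=D and S=S]) (use nonneg bdd supp in auto)
  have D: "0 \<le> D" using nonneg bdd order_trans by blast
  obtain B where B: "\<And>p. p \<in> S \<Longrightarrow> norm p \<le> B" using supp(1) by (auto simp: bounded_iff)
  have sup': "f p = 0" if "B < norm p" for p using that supp(2)[of p] B[of p] by linarith
  have int1: "integrable lborel (\<lambda>t. f (t, 0))"
    by (rule integrable_lborel_bounded_support[where D=D and S="cball 0 B"])
       (use nonneg bdd sup' in \<open>auto simp: norm_Pair\<close>)
  have int2: "integrable lborel (\<lambda>s. f (0, s))"
    by (rule integrable_lborel_bounded_support[where D=D and S="cball 0 B"])
       (use nonneg bdd sup' in \<open>auto simp: norm_Pair\<close>)
  have mom: "integrable lborel (\<lambda>p. fst p * f p)" "integrable lborel (\<lambda>p. snd p * f p)"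
  proof -
    have *: "\<bar>fst p\<bar> \<le> norm p" "\<bar>snd p\<bar> \<le> norm p" for p :: "real \<times> real"
      using norm_fst_le[of "fst p" "snd p"] norm_snd_le[of "snd p" "fst p"] by auto
    have **: "\<bar>c\<bar> * f p \<le> \<bar>B\<bar> * D" if "\<bar>c\<bar> \<le> norm p" for c p
    proof (cases "norm p \<le> B")
      case True then show ?thesis using that nonneg[of p] bdd[of p] by (intro mult_mono) auto
    qed (use sup'[of p] D in auto)
    have [measurable]: "fst \<in> borel_measurable (borel :: (real \<times> real) measure)"
      "snd \<in> borel_measurable (borel :: (real \<times> real) measure)"
      by (intro borel_measurable_continuous_onI continuous_intros)+
    show "integrable lborel (\<lambda>p. fst p * f p)"
      by (rule integrable_lborel_bounded_support[where D="\<bar>B\<bar> * D" and S=S])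
         (use **[OF *(1)] nonneg supp in \<open>auto simp: abs_mult\<close>)
    show "integrable lborel (\<lambda>p. snd p * f p)"
      by (rule integrable_lborel_bounded_support[where D="\<bar>B\<bar> * D" and S=S])
         (use **[OF *(2)] nonneg supp in \<open>auto simp: abs_mult\<close>)
  qed
  have "(\<integral>p. (a \<bullet> p) * f p \<partial>lborel) = 0" for a
  proof -
    have "(\<integral>p. (a \<bullet> p) * f p \<partial>lborel) = (\<integral>p. fst a * (fst p * f p) + snd a * (snd p * f p) \<partial>lborel)"
      by (simp add: inner_prod_def algebra_simps)
    then show ?thesis using mom cent by simp
  qed
  then have bary: "f p \<le> exp 6 * f (0, 0)" for p
    using log_concave_barycentre_bound[of f D S p] nonneg bdd supp lc pos by (simp add: zero_prod_def)
  define M where "M = exp 6 * f (0, 0)"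
  \<comment> \<open>With \<open>M = 0\<close> the barycentre bound would force \<open>f\<close> to
    vanish identically; positivity at the origin thus follows from positive mass.\<close>
  have M: "0 < M"
  proof (rule ccontr)
    assume "\<not> 0 < M"
    then have "f p = 0" for p using bary[of p] nonneg[of p] by (simp add: M_def)
    then show False using pos by simp
  qed
  \<comment> \<open>The zero term keeps the right-hand side in the shape of the midpoint
    substitution with \<open>a = 0\<close>.\<close>
  have pt: "f (t, 0) * f (0, s) \<le> M * f ((1/2) *\<^sub>R 0 + (1/2) *\<^sub>R (t, s))" for t s
  proof -
    have "sqrt (f (t, 0) * f (0, s)) \<le> M"
      using bary[of "(t, 0)"] bary[of "(0, s)"] nonneg mult_mono[of "f (t,0)" M "f (0,s)" M] M
      by (intro real_le_lsqrt) (auto simp: M_def power2_eq_square)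
    moreover have "sqrt (f (t, 0) * f (0, s)) \<le> f ((1/2) *\<^sub>R 0 + (1/2) *\<^sub>R (t, s))"
      using lc[of "1/2" "(t, 0)" "(0, s)"] nonneg by (simp add: powr_half_sqrt real_sqrt_mult)
    ultimately have "sqrt (f (t, 0) * f (0, s)) * sqrt (f (t, 0) * f (0, s)) \<le> M * f ((1/2) *\<^sub>R 0 + (1/2) *\<^sub>R (t, s))"
      using M nonneg by (intro mult_mono) auto
    then show ?thesis using nonneg by simp
  qed
  have "(\<lambda>(t, s). f (t, 0) * f (0, s)) \<in> borel_measurable (borel \<Otimes>\<^sub>M borel)"
    by measurable
  then have "integrable lborel (\<lambda>(t, s). f (t, 0) * f (0, s))"
    using nonneg bdd D sup'[of "(_, 0)"] sup'[of "(0, _)"]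
    by (intro integrable_lborel_bounded_support[where D="D * D" and S="cball 0 B \<times> cball 0 B"])
       (auto simp: borel_prod norm_Pair abs_mult not_le intro!: mult_mono bounded_Times intro: ccontr)
  then have prod: "integrable (lborel \<Otimes>\<^sub>M lborel) (\<lambda>(t, s). f (t, 0) * f (0, s))"
    by (simp add: lborel_prod)
  have "(\<integral>t. f (t, 0) \<partial>lborel) * (\<integral>s. f (0, s) \<partial>lborel) = (\<integral>t. (\<integral>s. f (t, 0) * f (0, s) \<partial>lborel) \<partial>lborel)"
    by simp
  also have "\<dots> = (\<integral>p. (case p of (t, s) \<Rightarrow> f (t, 0) * f (0, s)) \<partial>(lborel \<Otimes>\<^sub>M lborel))"
    using lborel_pair.integral_fst'[OF prod] by simp
  also have "\<dots> = (\<integral>p. (case p of (t, s) \<Rightarrow> f (t, 0) * f (0, s)) \<partial>lborel)"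
    by (simp add: lborel_prod)
  also have "\<dots> \<le> (\<integral>p. M * f ((1/2) *\<^sub>R 0 + (1/2) *\<^sub>R p) \<partial>lborel)"
    by (rule integral_mono)
       (use prod integral_lborel_midpoint(1)[OF int_f, of 0] pt in \<open>auto simp: lborel_prod\<close>)
  also have "\<dots> = 4 * exp 6 * f (0, 0) * (\<integral>p. f p \<partial>lborel)"
    using integral_lborel_midpoint(2)[OF int_f, of 0] by (simp add: M_def)
  finally show ?thesis .
qed

section \<open>Rotation invariance\<close>

lemma embed_Rn: "embed n k b y \<in> Rn n"
  by (auto simp: embed_def Rn_def PiE_iff extensional_def)

lemma measurable_embed [measurable]: "embed n k b \<in> measurable (lebn k) (lebn n)"
  by (rule measurable_lebnI) (auto simp: embed_def embed_Rn[unfolded embed_def])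

lemma ipr_embed_left: "ipr n (embed n k b y) z = (\<Sum>j<k. y j * ipr n (b j) z)"
proof -
  have "ipr n (embed n k b y) z = (\<Sum>i<n. \<Sum>j<k. y j * (b j i * z i))"
    by (simp add: ipr_def embed_def sum_distrib_right mult.assoc)
  also have "\<dots> = (\<Sum>j<k. \<Sum>i<n. y j * (b j i * z i))" by (rule sum.swap)
  finally show ?thesis by (simp add: ipr_def sum_distrib_left)
qed

lemma ipr_commute: "ipr n x y = ipr n y x"
  by (simp add: ipr_def mult.commute)

lemma ipr_embed_basis:
  assumes "orthonormal_fam n k b" "l < k"
  shows "ipr n (embed n k b y) (b l) = y l"
proof -
  have "ipr n (embed n k b y) (b l) = (\<Sum>j<k. y j * (if j = l then 1 else 0))"
    unfolding ipr_embed_left using assms by (intro sum.cong) (auto simp: orthonormal_fam_def)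
  then show ?thesis using assms(2) by (simp add: if_distrib cong: if_cong)
qed

lemma ipr_embed_embed:
  assumes "orthonormal_fam n k b"
  shows "ipr n (embed n k b y) (embed n k b z) = (\<Sum>j<k. y j * z j)"
  unfolding ipr_embed_left
proof (rule sum.cong)
  fix j assume "j \<in> {..<k}"
  then show "y j * ipr n (b j) (embed n k b z) = y j * z j"
    using ipr_embed_basis[OF assms, of j z] ipr_commute[of n "b j"] by simp
qed simp

text \<open>The squared distance from the \<open>i\<close>-th standard vector to the span of the family is
  \<open>1 - (\<Sum>j<n. (b j i)\<^sup>2)\<close>; these numbers are nonnegative and sum to zero.\<close>
lemma orthonormal_fam_dual:
  assumes b: "orthonormal_fam n n b" and "i < n" "i' < n"
  shows "(\<Sum>j<n. b j i * b j i') = (if i = i' then 1 else 0)"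
proof -
  define d where "d i i' = (if i = i' then 1 else (0::real))" for i i' :: nat
  define P where "P i = (\<Sum>i'<n. (d i i' - (\<Sum>j<n. b j i * b j i'))\<^sup>2)" for i
  define S where "S i = (\<Sum>j<n. (b j i)\<^sup>2)" for i
  have PS: "P i = 1 - S i" if i: "i < n" for i
  proof -
    have 1: "(\<Sum>i'<n. (d i i')\<^sup>2) = 1"
    proof -
      have "(d i i')\<^sup>2 = d i i'" for i' by (simp add: d_def)
      then show ?thesis using i by (simp add: d_def)
    qed
    have 2: "(\<Sum>i'<n. d i i' * (\<Sum>j<n. b j i * b j i')) = S i"
      using i by (simp add: d_def S_def if_distrib if_distribR power2_eq_square cong: if_cong)
    have "embed n n b (\<lambda>j. b j i) i' = (\<Sum>j<n. b j i * b j i')" if "i' < n" for i'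
      using that by (simp add: embed_def)
    then have 3: "(\<Sum>i'<n. (\<Sum>j<n. b j i * b j i')\<^sup>2) = S i"
      using ipr_embed_embed[OF b, of "\<lambda>j. b j i" "\<lambda>j. b j i"] by (simp add: ipr_def S_def power2_eq_square)
    have "P i = (\<Sum>i'<n. (d i i')\<^sup>2) - 2 * (\<Sum>i'<n. d i i' * (\<Sum>j<n. b j i * b j i')) + (\<Sum>i'<n. (\<Sum>j<n. b j i * b j i')\<^sup>2)"
      unfolding P_def power2_diff by (simp add: sum.distrib sum_subtractf sum_distrib_left mult.assoc)
    then show ?thesis using 1 2 3 by simp
  qed
  \<comment> \<open>Here the number of vectors has to equal the dimension: the squared norms of the
    \<open>b j\<close> add up to \<open>n\<close>, so the \<open>n\<close> defects
    \<open>1 - S i\<close> add up to \<open>0\<close>.\<close>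
  have "(\<Sum>i<n. S i) = (\<Sum>j<n. \<Sum>i<n. (b j i)\<^sup>2)" unfolding S_def by (rule sum.swap)
  also have "\<dots> = (\<Sum>j<n. 1)"
    using b by (intro sum.cong) (auto simp: orthonormal_fam_def ipr_def power2_eq_square)
  finally have "(\<Sum>i<n. P i) = 0" using PS by (simp add: sum_subtractf)
  then have "P i = 0" using \<open>i < n\<close> by (subst (asm) sum_nonneg_eq_0_iff) (auto simp: P_def sum_nonneg)
  then have "(d i i' - (\<Sum>j<n. b j i * b j i'))\<^sup>2 = 0"
    using \<open>i' < n\<close> unfolding P_def by (subst (asm) sum_nonneg_eq_0_iff) auto
  then show ?thesis by (simp add: d_def)
qed

text \<open>Exchanging the sums reduces this to the dual orthogonality relations. It makes
  \<open>embed n n b\<close> surjective, with the coordinates of a preimage given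
  explicitly.\<close>

lemma orthonormal_fam_expand:
  assumes b: "orthonormal_fam n n b" and x: "x \<in> Rn n"
  shows "embed n n b (\<lambda>j. ipr n x (b j)) = x"
proof
  fix i show "embed n n b (\<lambda>j. ipr n x (b j)) i = x i"
  proof (cases "i < n")
    case True
    have "(\<Sum>j<n. (\<Sum>i'<n. x i' * b j i') * b j i) = (\<Sum>j<n. \<Sum>i'<n. x i' * (b j i' * b j i))"
      by (simp add: sum_distrib_right mult.assoc)
    also have "\<dots> = (\<Sum>i'<n. x i' * (\<Sum>j<n. b j i' * b j i))"
      unfolding sum_distrib_left by (rule sum.swap)
    also have "\<dots> = (\<Sum>i'<n. x i' * (if i' = i then 1 else 0))"
      using True by (intro sum.cong) (auto simp: orthonormal_fam_dual[OF b])
    also have "\<dots> = x i" using True by (simp add: if_distrib cong: if_cong)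
    finally show ?thesis using True by (simp add: embed_def ipr_def)
  next
    case False then show ?thesis using x by (auto simp: embed_def Rn_def PiE_iff extensional_def)
  qed
qed

section \<open>Translations and uniqueness of the invariant measure\<close>

text \<open>Truncation keeps sums extensional. Only values below \<open>n\<close> are read, so
  \<open>\<lambda>i. - x i\<close> can serve as an argument although it is not itself in
  \<open>Rn n\<close>.\<close>

definition vadd :: "nat \<Rightarrow> (nat \<Rightarrow> real) \<Rightarrow> (nat \<Rightarrow> real) \<Rightarrow> (nat \<Rightarrow> real)" where
  "vadd n a x = (\<lambda>i. if i < n then a i + x i else undefined)"

lemma vadd_Rn: "vadd n a x \<in> Rn n"
  by (auto simp: vadd_def Rn_def PiE_iff extensional_def)

lemma measurable_vadd [measurable (raw)]:
  assumes "\<And>i. i < n \<Longrightarrow> (\<lambda>x. f x i) \<in> borel_measurable M" "g \<in> measurable M (lebn n)"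
  shows "(\<lambda>x. vadd n (f x) (g x)) \<in> measurable M (lebn n)"
proof (rule measurable_lebnI)
  fix i assume i: "i < n"
  have "(\<lambda>x. g x i) \<in> borel_measurable M" using measurable_compose[OF assms(2) measurable_lebn_component[OF i]] .
  then show "(\<lambda>x. vadd n (f x) (g x) i) \<in> borel_measurable M" using assms(1)[OF i] i by (simp add: vadd_def)
qed (simp add: vadd_Rn)

text \<open>Boxes determine the product measure, and the preimage of a box is a box with translated
  sides, so one-dimensional translation invariance suffices.\<close>

lemma distr_lebn_vadd: "distr (lebn n) (lebn n) (vadd n a) = lebn n"
proof -
  have meas: "vadd n a \<in> measurable (lebn n) (lebn n)"
    using measurable_vadd[of n "\<lambda>_. a" "lebn n" "\<lambda>x. x"] by simp
  have "distr (lebn n) (lebn n) (vadd n a) = PiM {..<n} (\<lambda>_. lborel)"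
  proof (rule lborel_nat.PiM_eqI)
    fix A :: "nat \<Rightarrow> real set" assume A: "\<And>i. i \<in> {..<n} \<Longrightarrow> A i \<in> sets lborel"
    have eq: "vadd n a -` Pi\<^sub>E {..<n} A \<inter> space (lebn n) = Pi\<^sub>E {..<n} (\<lambda>i. {x. a i + x \<in> A i})"
    proof (intro set_eqI iffI)
      fix x assume "x \<in> vadd n a -` Pi\<^sub>E {..<n} A \<inter> space (lebn n)"
      then have "x \<in> Rn n" "\<forall>i<n. vadd n a x i \<in> A i" by (auto simp: PiE_iff)
      then show "x \<in> Pi\<^sub>E {..<n} (\<lambda>i. {x. a i + x \<in> A i})" by (simp add: vadd_def Rn_def PiE_iff)
    next
      fix x assume "x \<in> Pi\<^sub>E {..<n} (\<lambda>i. {x. a i + x \<in> A i})"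
      then have "x \<in> Rn n" "\<forall>i<n. vadd n a x i \<in> A i" by (auto simp: PiE_iff Rn_def vadd_def)
      then show "x \<in> vadd n a -` Pi\<^sub>E {..<n} A \<inter> space (lebn n)"
        using vadd_Rn[of n a x] by (simp add: PiE_iff Rn_def)
    qed
    have A': "{x. a i + x \<in> A i} \<in> sets borel" if "i < n" for i
    proof -
      have [measurable]: "A i \<in> sets borel" using A[of i] that by simp
      show ?thesis by measurable
    qed
    have tr: "emeasure lborel {x. a i + x \<in> A i} = emeasure lborel (A i)" if "i < n" for i
    proof -
      have [measurable]: "A i \<in> sets borel" using A[of i] that by simp
      have "emeasure lborel (A i) = (\<integral>\<^sup>+x. indicator (A i) (a i + x) \<partial>lborel)"
        using nn_integral_real_affine[of "indicator (A i)" 1 "a i"] by simp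
      also have "\<dots> = (\<integral>\<^sup>+x. indicator {x. a i + x \<in> A i} x \<partial>lborel)"
        by (intro nn_integral_cong) (auto simp: indicator_def)
      finally show ?thesis using A'[OF that] by simp
    qed
    have "Pi\<^sub>E {..<n} A \<in> sets (lebn n)" unfolding lebn_def using A by (intro sets_PiM_I_finite) auto
    then have "emeasure (distr (lebn n) (lebn n) (vadd n a)) (Pi\<^sub>E {..<n} A)
      = emeasure (lebn n) (Pi\<^sub>E {..<n} (\<lambda>i. {x. a i + x \<in> A i}))"
      using meas eq by (simp add: emeasure_distr)
    also have "\<dots> = (\<Prod>i<n. emeasure lborel {x. a i + x \<in> A i})"
      unfolding lebn_def using A' by (intro lborel_nat.emeasure_PiM) auto
    also have "\<dots> = (\<Prod>i<n. emeasure lborel (A i))" using tr by simp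
    finally show "emeasure (distr (lebn n) (lebn n) (vadd n a)) (Pi\<^sub>E {..<n} A) = (\<Prod>i\<in>{..<n}. emeasure lborel (A i))" .
  qed (auto simp: lebn_def)
  then show ?thesis by (simp add: lebn_def)
qed

lemma nn_integral_lebn_vadd:
  assumes [measurable]: "f \<in> borel_measurable (lebn n)"
  shows "(\<integral>\<^sup>+x. f (vadd n a x) \<partial>lebn n) = (\<integral>\<^sup>+x. f x \<partial>lebn n)"
  using nn_integral_distr[of "vadd n a" "lebn n" "lebn n" f] measurable_vadd[of n "\<lambda>_. a" "lebn n" "\<lambda>x. x"]
  by (simp add: distr_lebn_vadd)

text \<open>Uniqueness of Haar measure: comparing \<open>\<integral>\<integral> 1\<^sub>A(x) 1\<^sub>B(x + T y)\<close> in both orders of integration,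
  where \<open>A\<close> is the unit ball, which is symmetric and fixed by the orthogonal map \<open>T\<close>.\<close>
lemma emeasure_embed_vimage:
  assumes q: "orthonormal_fam k k q" and B [measurable]: "B \<in> sets (lebn k)"
  shows "emeasure (lebn k) {y \<in> Rn k. embed k k q y \<in> B} = emeasure (lebn k) B"
proof -
  let ?T = "embed k k q"
  define A where "A = {x \<in> space (lebn k). (\<Sum>i<k. (x i)\<^sup>2) < 1}"
  have A [measurable]: "A \<in> sets (lebn k)" unfolding A_def by measurable
  interpret pair_sigma_finite "lebn k" "lebn k"
    by (intro pair_sigma_finite.intro sigma_finite_lebn)
  have TA: "?T y \<in> A \<longleftrightarrow> y \<in> A" if "y \<in> Rn k" for y
    using ipr_embed_embed[OF q, of y y] that embed_Rn[of k k q y]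
    by (simp add: A_def ipr_def power2_eq_square)
  \<comment> \<open>\<open>?T\<close> is onto, so \<open>x + ?T y = ?T (x' + y)\<close> where
    \<open>x'\<close> lists the coordinates of \<open>x\<close>; translation invariance in
    \<open>y\<close> absorbs \<open>x'\<close>.\<close>
  have tr: "(\<integral>\<^sup>+y. indicator C (vadd k x (?T y)) \<partial>lebn k) = (\<integral>\<^sup>+y. indicator C (?T y) \<partial>lebn k)"
    if x: "x \<in> Rn k" and [measurable]: "C \<in> sets (lebn k)" for C :: "(nat \<Rightarrow> real) set" and x
  proof -
    have "vadd k x (?T y) = ?T (vadd k (\<lambda>j. ipr k x (q j)) y)" for y
    proof
      fix i show "vadd k x (?T y) i = ?T (vadd k (\<lambda>j. ipr k x (q j)) y) i"
        using fun_cong[OF orthonormal_fam_expand[OF q x], of i]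
        by (auto simp: embed_def vadd_def distrib_right sum.distrib split: if_splits)
    qed
    then show ?thesis
      using nn_integral_lebn_vadd[of "\<lambda>y. indicator C (?T y)" k "\<lambda>j. ipr k x (q j)"] by simp
  qed
  \<comment> \<open>\<open>x - ?T y\<close> and \<open>?T y - x\<close> have the same norm. This
    rewrites a translate by a vector depending on \<open>y\<close> as the translate by
    \<open>- x\<close> that \<open>trA\<close> evaluates.\<close>
  have neg: "vadd k (\<lambda>i. - ?T y i) x \<in> A \<longleftrightarrow> vadd k (\<lambda>i. - x i) (?T y) \<in> A" for x y
  proof -
    have "(\<Sum>i<k. (vadd k (\<lambda>i. - ?T y i) x i)\<^sup>2) = (\<Sum>i<k. (vadd k (\<lambda>i. - x i) (?T y) i)\<^sup>2)"
      by (intro sum.cong) (auto simp: vadd_def power2_commute)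
    then show ?thesis by (simp add: A_def vadd_Rn)
  qed
  have trA: "(\<integral>\<^sup>+y. indicator A (vadd k (\<lambda>i. - x i) (?T y)) \<partial>lebn k) = emeasure (lebn k) A" for x
  proof -
    let ?x = "\<lambda>i. if i < k then - x i else undefined"
    have "?x \<in> Rn k" by (auto simp: Rn_def PiE_iff extensional_def)
    moreover have "vadd k (\<lambda>i. - x i) (?T y) = vadd k ?x (?T y)" for y by (auto simp: vadd_def)
    ultimately have "(\<integral>\<^sup>+y. indicator A (vadd k (\<lambda>i. - x i) (?T y)) \<partial>lebn k) = (\<integral>\<^sup>+y. indicator A (?T y) \<partial>lebn k)"
      using tr[of ?x A] by simp
    also have "\<dots> = (\<integral>\<^sup>+y. indicator A y \<partial>lebn k)"
      using TA by (intro nn_integral_cong) (auto simp: indicator_def)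
    finally show ?thesis by simp
  qed
  have [measurable]: "(\<lambda>p. vadd k (fst p) (?T (snd p))) \<in> measurable (lebn k \<Otimes>\<^sub>M lebn k) (lebn k)"
    by (intro measurable_vadd) (auto intro: measurable_compose[OF measurable_fst] measurable_compose[OF measurable_snd])
  have [measurable]: "(\<lambda>p. vadd k (\<lambda>i. - ?T (snd p) i) (fst p)) \<in> measurable (lebn k \<Otimes>\<^sub>M lebn k) (lebn k)"
  proof (intro measurable_vadd)
    fix i assume "i < k"
    then have "(\<lambda>x. ?T x i) \<in> borel_measurable (lebn k)"
      using measurable_compose[OF measurable_embed measurable_lebn_component] by blast
    from measurable_compose[OF measurable_snd this]
    show "(\<lambda>x. - ?T (snd x) i) \<in> borel_measurable (lebn k \<Otimes>\<^sub>M lebn k)" by simp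
  qed simp
  have [measurable]: "vadd k a \<in> measurable (lebn k) (lebn k)" for a
    using measurable_vadd[of k "\<lambda>_. a" "lebn k" "\<lambda>x. x"] by simp
  have pre: "{y \<in> Rn k. ?T y \<in> B} \<in> sets (lebn k)"
    using measurable_sets[OF measurable_embed B, of k q] by (simp add: vimage_def Int_def conj_commute)
  have "(\<integral>\<^sup>+y. indicator B (?T y) \<partial>lebn k) = (\<integral>\<^sup>+y. indicator {y \<in> Rn k. ?T y \<in> B} y \<partial>lebn k)"
    by (intro nn_integral_cong) (auto simp: indicator_def)
  then have "emeasure (lebn k) A * emeasure (lebn k) {y \<in> Rn k. ?T y \<in> B}
    = emeasure (lebn k) A * (\<integral>\<^sup>+y. indicator B (?T y) \<partial>lebn k)"
    using pre by simp
  also have "\<dots> = (\<integral>\<^sup>+x. indicator A x * (\<integral>\<^sup>+y. indicator B (?T y) \<partial>lebn k) \<partial>lebn k)"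
    by (simp add: nn_integral_multc)
  also have "\<dots> = (\<integral>\<^sup>+x. indicator A x * (\<integral>\<^sup>+y. indicator B (vadd k x (?T y)) \<partial>lebn k) \<partial>lebn k)"
    using tr[of _ B] by (intro nn_integral_cong) simp
  also have "\<dots> = (\<integral>\<^sup>+x. \<integral>\<^sup>+y. indicator A x * indicator B (vadd k x (?T y)) \<partial>lebn k \<partial>lebn k)"
    by (intro nn_integral_cong nn_integral_cmult[symmetric]) (auto intro!: measurable_compose[OF _ borel_measurable_indicator] measurable_compose[OF measurable_embed])
  also have "\<dots> = (\<integral>\<^sup>+y. \<integral>\<^sup>+x. indicator A x * indicator B (vadd k x (?T y)) \<partial>lebn k \<partial>lebn k)"
    by (rule Fubini') (simp add: case_prod_beta)
  \<comment> \<open>Replacing \<open>x\<close> by \<open>x - ?T y\<close> moves the translation from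
    \<open>B\<close> to \<open>A\<close>; once the integrals are swapped, the inner one is the
    measure of the ball times the indicator of \<open>B\<close>.\<close>
  also have "\<dots> = (\<integral>\<^sup>+y. \<integral>\<^sup>+x. indicator A (vadd k (\<lambda>i. - ?T y i) x) * indicator B x \<partial>lebn k \<partial>lebn k)"
  proof (rule nn_integral_cong)
    fix y
    have *: "vadd k (vadd k (\<lambda>i. - ?T y i) x) (?T y) = x" if "x \<in> Rn k" for x
      using that by (auto simp: vadd_def fun_eq_iff Rn_def PiE_iff extensional_def)
    have "vadd k x (?T y) = vadd k (?T y) x" for x by (auto simp: vadd_def add.commute)
    then have [measurable]: "(\<lambda>x. vadd k x (?T y)) \<in> measurable (lebn k) (lebn k)" by simp
    have "(\<integral>\<^sup>+x. indicator A x * indicator B (vadd k x (?T y)) \<partial>lebn k)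
      = (\<integral>\<^sup>+x. indicator A (vadd k (\<lambda>i. - ?T y i) x) * indicator B (vadd k (vadd k (\<lambda>i. - ?T y i) x) (?T y)) \<partial>lebn k)"
      by (rule nn_integral_lebn_vadd[symmetric]) simp
    also have "\<dots> = (\<integral>\<^sup>+x. indicator A (vadd k (\<lambda>i. - ?T y i) x) * indicator B x \<partial>lebn k)"
      by (intro nn_integral_cong) (simp add: *)
    finally show "(\<integral>\<^sup>+x. indicator A x * indicator B (vadd k x (?T y)) \<partial>lebn k) = \<dots>" .
  qed
  also have "\<dots> = (\<integral>\<^sup>+x. \<integral>\<^sup>+y. indicator A (vadd k (\<lambda>i. - ?T y i) x) * indicator B x \<partial>lebn k \<partial>lebn k)"
    by (rule Fubini'[symmetric]) (simp add: case_prod_beta)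
  also have "\<dots> = (\<integral>\<^sup>+x. (\<integral>\<^sup>+y. indicator A (vadd k (\<lambda>i. - x i) (?T y)) * indicator B x \<partial>lebn k) \<partial>lebn k)"
    by (intro nn_integral_cong) (simp add: indicator_def neg)
  also have "\<dots> = (\<integral>\<^sup>+x. emeasure (lebn k) A * indicator B x \<partial>lebn k)"
  proof (rule nn_integral_cong)
    fix x
    have "(\<integral>\<^sup>+y. indicator A (vadd k (\<lambda>i. - x i) (?T y)) * indicator B x \<partial>lebn k)
      = (\<integral>\<^sup>+y. indicator A (vadd k (\<lambda>i. - x i) (?T y)) \<partial>lebn k) * indicator B x"
      by (rule nn_integral_multc) measurable
    then show "(\<integral>\<^sup>+y. indicator A (vadd k (\<lambda>i. - x i) (?T y)) * indicator B x \<partial>lebn k) = emeasure (lebn k) A * indicator B x"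
      by (simp add: trA)
  qed
  also have "\<dots> = emeasure (lebn k) A * emeasure (lebn k) B"
    by (simp add: nn_integral_cmult)
  finally have eq: "emeasure (lebn k) A * emeasure (lebn k) {y \<in> Rn k. ?T y \<in> B} = emeasure (lebn k) A * emeasure (lebn k) B" .
  have Asub: "A \<subseteq> cube k 1"
  proof
    fix x assume x: "x \<in> A"
    have "\<bar>x i\<bar> \<le> 1" if "i < k" for i
    proof -
      have "(x i)\<^sup>2 \<le> (\<Sum>i<k. (x i)\<^sup>2)" using that by (intro member_le_sum) auto
      then have "(x i)\<^sup>2 \<le> 1" using x by (auto simp: A_def)
      then show ?thesis by (simp add: abs_square_le_1)
    qed
    then show "x \<in> cube k 1" using x by (auto simp: cube_iff A_def)
  qed
  \<comment> \<open>The ball lies between two cubes, so its measure is finite and nonzero and may be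
    cancelled. With half-side \<open>1 / (k + 1)\<close> the \<open>k\<close> squares sum to at most
    \<open>k / (k + 1) < 1\<close>, also for \<open>k = 0\<close>.\<close>
  have sub: "cube k (1 / (real k + 1)) \<subseteq> A"
  proof
    fix x assume x: "x \<in> cube k (1 / (real k + 1))"
    have "(x i)\<^sup>2 \<le> 1 / (real k + 1)" if "i < k" for i
    proof -
      have "\<bar>x i\<bar> \<le> 1 / (real k + 1)" "1 / (real k + 1) \<le> 1" using x that by (auto simp: cube_iff)
      moreover from this have "\<bar>x i\<bar> \<le> 1" by (rule order_trans)
      ultimately have "\<bar>x i\<bar> * \<bar>x i\<bar> \<le> 1 / (real k + 1) * 1" by (intro mult_mono) auto
      then show ?thesis by (simp add: power2_eq_square)
    qed
    then have "(\<Sum>i<k. (x i)\<^sup>2) \<le> (\<Sum>i<k. 1 / (real k + 1))" by (intro sum_mono) auto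
    also have "\<dots> < 1" by (simp add: field_simps)
    finally show "x \<in> A" using x by (auto simp: A_def cube_iff)
  qed
  have "0 < emeasure (lebn k) (cube k (1 / (real k + 1)))" by (simp add: emeasure_cube)
  also have "\<dots> \<le> emeasure (lebn k) A" by (intro emeasure_mono sub A)
  finally have "emeasure (lebn k) A \<noteq> 0" by simp
  moreover have "emeasure (lebn k) A \<noteq> top" using emeasure_subset_cube(1)[OF Asub] by simp
  ultimately show ?thesis using eq by (simp add: ennreal_mult_cancel_left)
qed

section \<open>Sections by coordinate subspaces\<close>

text \<open>Coordinates \<open>m\<close> and \<open>Suc m\<close> play the roles of \<open>t\<close>
  and \<open>s\<close>. In the second section coordinate \<open>m\<close> is fixed to
  \<open>0\<close>, so the last free coordinate \<open>y m\<close> of \<open>Rn (Suc m)\<close>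
  moves to slot \<open>Suc m\<close>.\<close>

lemma coordinate_section_product_bound:
  assumes L [measurable]: "L \<in> sets (lebn (Suc (Suc m)))" and cube: "L \<subseteq> cube (Suc (Suc m)) R" "0 \<le> R"
    and conv: "\<And>x y l. x \<in> L \<Longrightarrow> y \<in> L \<Longrightarrow> 0 < l \<Longrightarrow> l < 1 \<Longrightarrow> mix (Suc (Suc m)) l x y \<in> L"
    and cent: "(\<integral>x. indicator L x * x m \<partial>lebn (Suc (Suc m))) = 0"
      "(\<integral>x. indicator L x * x (Suc m) \<partial>lebn (Suc (Suc m))) = 0"
    and pos: "0 < measure (lebn (Suc (Suc m))) L"
  shows "measure (lebn (Suc m)) {y \<in> Rn (Suc m). y(Suc m := 0) \<in> L}
      * measure (lebn (Suc m)) {y \<in> Rn (Suc m). y(m := 0, Suc m := y m) \<in> L}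
    \<le> 4 * exp 6 * measure (lebn m) {y \<in> Rn m. y(m := 0, Suc m := 0) \<in> L} * measure (lebn (Suc (Suc m))) L"
proof -
  define Z where "Z p = {y \<in> Rn m. y(m := fst p, Suc m := snd p) \<in> L}" for p :: "real \<times> real"
  define f where "f p = measure (lebn m) (Z p)" for p
  let ?N = "lebn (Suc (Suc m))"
  have Z_sec: "Z p = sec m (sec (Suc m) L (snd p)) (fst p)" for p
    by (auto simp: Z_def sec_def Rn_upd)
  have Z_sets [measurable]: "Z p \<in> sets (lebn m)" for p unfolding Z_sec by simp
  have Z_cube: "Z p \<subseteq> cube m R" for p
    unfolding Z_sec using sec_cube[OF sec_cube[OF cube(1)]] .
  have Z_ind: "indicator L (y(m := fst p, Suc m := snd p)) = (indicator (Z p) y :: ennreal)" if "y \<in> Rn m" for y p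
    using that by (auto simp: Z_def indicator_def)
  have em_Z: "emeasure (lebn m) (Z p) = ennreal (f p)" for p
    unfolding f_def by (rule emeasure_subset_cube(1)[OF Z_cube cube(2)])
  interpret sigma_finite_measure "lebn m" by (rule sigma_finite_lebn)
  \<comment> \<open>Joint measurability in the plane point and the fibre point makes
    \<open>f\<close> a parameter integral, hence Borel on the plane.\<close>
  have [measurable]: "(\<lambda>q. (snd q)(m := fst (fst q), Suc m := snd (fst q))) \<in> measurable (borel \<Otimes>\<^sub>M lebn m) ?N"
  proof (rule measurable_lebnI)
    fix i assume i: "i < Suc (Suc m)"
    have [measurable]: "fst \<in> borel_measurable (borel :: (real \<times> real) measure)"
      "snd \<in> borel_measurable (borel :: (real \<times> real) measure)"
      by (intro borel_measurable_continuous_onI continuous_intros)+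
    consider "i = Suc m" | "i = m" | "i < m" using i by linarith
    then show "(\<lambda>x. ((snd x)(m := fst (fst x), Suc m := snd (fst x))) i) \<in> borel_measurable (borel \<Otimes>\<^sub>M lebn m :: ((real \<times> real) \<times> (nat \<Rightarrow> real)) measure)"
    proof cases
      case 3
      then show ?thesis using measurable_compose[OF measurable_snd measurable_lebn_component[OF 3]] by simp
    qed auto
  qed (auto simp: space_pair_measure Rn_upd)
  have "(\<lambda>p. \<integral>\<^sup>+y. indicator L (y(m := fst p, Suc m := snd p)) \<partial>lebn m) \<in> borel_measurable borel"
    by (intro borel_measurable_nn_integral) (simp add: case_prod_beta)
  moreover have "(\<integral>\<^sup>+y. indicator L (y(m := fst p, Suc m := snd p)) \<partial>lebn m) = emeasure (lebn m) (Z p)" for p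
  proof -
    have "(\<integral>\<^sup>+y. indicator L (y(m := fst p, Suc m := snd p)) \<partial>lebn m) = (\<integral>\<^sup>+y. indicator (Z p) y \<partial>lebn m)"
      using Z_ind by (intro nn_integral_cong) simp
    then show ?thesis by simp
  qed
  ultimately have "(\<lambda>p. enn2real (emeasure (lebn m) (Z p))) \<in> borel_measurable borel" by simp
  then have f_meas [measurable]: "f \<in> borel_measurable borel" by (simp add: f_def[abs_def] measure_def)
  have f0: "0 \<le> f p" for p by (simp add: f_def)
  have fD: "f p \<le> (2 * R) ^ m" for p
    unfolding f_def by (rule emeasure_subset_cube(2)[OF Z_cube cube(2)])
  have fS: "f p = 0" if "p \<notin> {-R..R} \<times> {-R..R}" for p
  proof -
    have "sec (Suc m) L (snd p) = {} \<or> sec m (sec (Suc m) L (snd p)) (fst p) = {}"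
      using sec_empty[OF cube(1), of "snd p"] sec_empty[OF sec_cube[OF cube(1)], of "fst p" "snd p"] that
      by (cases p) auto
    then have "Z p = {}" unfolding Z_sec by (auto simp: sec_def)
    then show ?thesis by (simp add: f_def)
  qed
  have bS: "bounded ({-R..R} \<times> {-R..R})" by (intro bounded_Times) auto
  have lc: "f p powr (1 - l) * f q powr l \<le> f ((1 - l) *\<^sub>R p + l *\<^sub>R q)" if l: "0 < l" "l < 1" for p q l
    unfolding f_def
  proof (rule brunn_minkowski_lebn[OF l cube(2)])
    fix x y assume "x \<in> Z p" "y \<in> Z q"
    then have "mix (Suc (Suc m)) l (x(m := fst p, Suc m := snd p)) (y(m := fst q, Suc m := snd q)) \<in> L"
      using l by (intro conv) (auto simp: Z_def)
    then show "mix m l x y \<in> Z ((1 - l) *\<^sub>R p + l *\<^sub>R q)"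
      by (simp add: Z_def mix_Suc mix_Rn del: fun_upd_apply)
  qed (use Z_cube in auto)
  have [measurable]: "(\<lambda>y. (y m, y (Suc m))) \<in> measurable ?N borel"
    by (intro borel_measurable_Pair) auto
  \<comment> \<open>Projecting the volume on \<open>L\<close> to its last two coordinates yields the
    measure with density \<open>f\<close>. This carries centredness and total volume of
    \<open>L\<close> over to the moments and mass of \<open>f\<close>.\<close>
  have distr: "distr (density ?N (indicator L)) borel (\<lambda>y. (y m, y (Suc m))) = density lborel (\<lambda>p. ennreal (f p))"
  proof (rule measure_eqI)
    fix A :: "(real \<times> real) set" assume "A \<in> sets (distr (density ?N (indicator L)) borel (\<lambda>y. (y m, y (Suc m))))"
    then have [measurable]: "A \<in> sets borel" by simp
    have Ap [measurable]: "A \<in> sets (lborel \<Otimes>\<^sub>M lborel)" unfolding lborel_prod by simp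
    have fp [measurable]: "f \<in> borel_measurable (lborel \<Otimes>\<^sub>M lborel)" unfolding lborel_prod by simp
    have "emeasure (distr (density ?N (indicator L)) borel (\<lambda>y. (y m, y (Suc m)))) A
      = (\<integral>\<^sup>+y. indicator A (y m, y (Suc m)) * indicator L y \<partial>?N)"
      by (subst nn_integral_indicator[symmetric], simp, subst nn_integral_distr, simp, simp,
          subst nn_integral_density) (auto simp: mult.commute)
    also have "\<dots> = (\<integral>\<^sup>+s. \<integral>\<^sup>+t. \<integral>\<^sup>+y. indicator A (t, s) * indicator L (y(m := t, Suc m := s)) \<partial>lebn m \<partial>lborel \<partial>lborel)"
    proof -
      have "(\<lambda>y. y(Suc m := s)) \<in> measurable (lebn (Suc m)) ?N" for s
        using measurable_compose[OF measurable_Pair2' measurable_lebn_upd[of "Suc m"], of s] by simp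
      note [measurable] = this
      have "(\<integral>\<^sup>+y. indicator A (y m, y (Suc m)) * indicator L y \<partial>?N)
        = (\<integral>\<^sup>+s. \<integral>\<^sup>+y. indicator A (y m, s) * indicator L (y(Suc m := s)) \<partial>lebn (Suc m) \<partial>lborel)"
        by (subst nn_integral_lebn_Suc) auto
      also have "\<dots> = (\<integral>\<^sup>+s. \<integral>\<^sup>+t. \<integral>\<^sup>+y. indicator A (t, s) * indicator L (y(m := t, Suc m := s)) \<partial>lebn m \<partial>lborel \<partial>lborel)"
      proof (rule nn_integral_cong)
        fix s :: real
        have "(\<lambda>y. (y m, s)) \<in> measurable (lebn (Suc m)) borel"
          by (intro borel_measurable_Pair) auto
        note [measurable] = this
        show "(\<integral>\<^sup>+y. indicator A (y m, s) * indicator L (y(Suc m := s)) \<partial>lebn (Suc m))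
          = (\<integral>\<^sup>+t. \<integral>\<^sup>+y. indicator A (t, s) * indicator L (y(m := t, Suc m := s)) \<partial>lebn m \<partial>lborel)"
          by (subst nn_integral_lebn_Suc) auto
      qed
      finally show ?thesis .
    qed
    also have "\<dots> = (\<integral>\<^sup>+s. \<integral>\<^sup>+t. indicator A (t, s) * ennreal (f (t, s)) \<partial>lborel \<partial>lborel)"
    proof (intro nn_integral_cong)
      fix s t :: real
      have "(\<integral>\<^sup>+y. indicator A (t, s) * indicator L (y(m := t, Suc m := s)) \<partial>lebn m)
        = (\<integral>\<^sup>+y. indicator A (t, s) * indicator (Z (t, s)) y \<partial>lebn m)"
        using Z_ind[of _ "(t, s)"] by (intro nn_integral_cong) simp
      also have "\<dots> = indicator A (t, s) * ennreal (f (t, s))"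
        using em_Z by (simp add: nn_integral_cmult)
      finally show "(\<integral>\<^sup>+y. indicator A (t, s) * indicator L (y(m := t, Suc m := s)) \<partial>lebn m) = \<dots>" .
    qed
    also have "\<dots> = (\<integral>\<^sup>+p. indicator A p * ennreal (f p) \<partial>(lborel \<Otimes>\<^sub>M lborel))"
      by (subst lborel_pair.nn_integral_snd[symmetric]) auto
    also have "\<dots> = emeasure (density lborel (\<lambda>p. ennreal (f p))) A"
      by (simp add: lborel_prod emeasure_density mult.commute)
    finally show "emeasure (distr (density ?N (indicator L)) borel (\<lambda>y. (y m, y (Suc m)))) A
      = emeasure (density lborel (\<lambda>p. ennreal (f p))) A" .
  qed simp
  have push: "(\<integral>p. h p * f p \<partial>lborel) = (\<integral>x. indicator L x * h (x m, x (Suc m)) \<partial>?N)"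
    if [measurable]: "h \<in> borel_measurable borel" for h :: "real \<times> real \<Rightarrow> real"
  proof -
    have "(\<integral>p. h p * f p \<partial>lborel) = (\<integral>p. h p \<partial>density lborel (\<lambda>p. ennreal (f p)))"
      using f0 by (subst integral_density) (auto simp: mult.commute)
    also have "\<dots> = (\<integral>x. h (x m, x (Suc m)) \<partial>density ?N (indicator L))"
      unfolding distr[symmetric] by (subst integral_distr) auto
    also have "density ?N (indicator L) = density ?N (\<lambda>x. ennreal (indicator L x))"
      by (intro density_cong) (auto simp: indicator_def)
    also have "(\<integral>x. h (x m, x (Suc m)) \<partial>density ?N (\<lambda>x. ennreal (indicator L x))) = (\<integral>x. indicator L x * h (x m, x (Suc m)) \<partial>?N)"
      by (subst integral_density) auto
    finally show ?thesis .
  qed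
  have [measurable]: "fst \<in> borel_measurable (borel :: (real \<times> real) measure)"
      "snd \<in> borel_measurable (borel :: (real \<times> real) measure)"
      by (intro borel_measurable_continuous_onI continuous_intros)+
  have c1: "(\<integral>p. fst p * f p \<partial>lborel) = 0" "(\<integral>p. snd p * f p \<partial>lborel) = 0"
    using push[of fst] push[of snd] cent by simp_all
  have tot: "(\<integral>p. f p \<partial>lborel) = measure ?N L"
    using push[of "\<lambda>_. 1"] sets.sets_into_space[OF L] by (simp add: Int_absorb2)
  have "(\<integral>t. f (t, 0) \<partial>lborel) * (\<integral>s. f (0, s) \<partial>lborel) \<le> 4 * exp 6 * f (0, 0) * (\<integral>p. f p \<partial>lborel)"
    by (rule log_concave_axis_product_bound[OF f_meas f0 fD bS fS lc c1]) (use tot pos in auto)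
  moreover have "(\<integral>t. f (t, 0) \<partial>lborel) = measure (lebn (Suc m)) {y \<in> Rn (Suc m). y(Suc m := 0) \<in> L}"
  proof -
    have "measure (lebn (Suc m)) (sec (Suc m) L 0) = (\<integral>t. measure (lebn m) (sec m (sec (Suc m) L 0) t) \<partial>lborel)"
      by (rule measure_lebn_Suc(2)[OF sets_sec[OF L] sec_cube[OF cube(1)] cube(2)])
    then show ?thesis by (simp add: f_def Z_sec) (simp add: sec_def)
  qed
  moreover have "(\<integral>s. f (0, s) \<partial>lborel) = measure (lebn (Suc m)) {y \<in> Rn (Suc m). y(m := 0, Suc m := y m) \<in> L}"
  proof -
    let ?M = "{y \<in> Rn (Suc m). y(m := 0, Suc m := y m) \<in> L}"
    have "(\<lambda>y. y(m := 0, Suc m := y m)) \<in> measurable (lebn (Suc m)) ?N"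
    proof (rule measurable_lebnI)
      fix i assume "i < Suc (Suc m)"
      then consider "i = Suc m" | "i = m" | "i < m" by linarith
      then show "(\<lambda>x. (x(m := 0, Suc m := x m)) i) \<in> borel_measurable (lebn (Suc m))"
        by cases auto
    qed (auto simp: Rn_def PiE_iff extensional_def)
    from measurable_sets[OF this L] have Ms: "?M \<in> sets (lebn (Suc m))"
      by (simp add: vimage_def Int_def conj_commute)
    have Mc: "?M \<subseteq> cube (Suc m) R"
    proof
      fix y assume y: "y \<in> ?M"
      then have *: "y(m := 0, Suc m := y m) \<in> cube (Suc (Suc m)) R" using cube(1) by auto
      have b: "\<bar>(y(m := 0, Suc m := y m)) j\<bar> \<le> R" if "j < Suc (Suc m)" for j
        using * that by (simp add: cube_iff del: fun_upd_apply)
      have "\<bar>y i\<bar> \<le> R" if "i < Suc m" for i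
        using b[of i] b[of "Suc m"] that by (cases "i = m") auto
      then show "y \<in> cube (Suc m) R" using y by (auto simp: cube_iff)
    qed
    have "sec m ?M s = Z (0, s)" for s
      by (auto simp: sec_def Z_def Rn_upd)
    then show ?thesis using measure_lebn_Suc(2)[OF Ms Mc cube(2)] by (simp add: f_def)
  qed
  moreover have "f (0, 0) = measure (lebn m) {y \<in> Rn m. y(m := 0, Suc m := 0) \<in> L}"
    by (simp add: f_def Z_def)
  ultimately show ?thesis using tot by simp
qed

section \<open>Sections by arbitrary subspaces\<close>

lemma embed_embed:
  assumes "\<And>j. j < k' \<Longrightarrow> b' j = embed n k b (q j)"
  shows "embed n k' b' y = embed n k b (embed k k' q y)"
proof
  fix i show "embed n k' b' y i = embed n k b (embed k k' q y) i"
  proof (cases "i < n")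
    case True
    have "(\<Sum>j<k'. y j * b' j i) = (\<Sum>j<k'. \<Sum>l<k. y j * q j l * b l i)"
      using True by (intro sum.cong) (auto simp: assms embed_def sum_distrib_left mult.assoc)
    also have "\<dots> = (\<Sum>l<k. \<Sum>j<k'. y j * q j l * b l i)" by (rule sum.swap)
    finally show ?thesis using True by (simp add: embed_def sum_distrib_right)
  qed (simp add: embed_def)
qed

lemma sets_embed_vimage:
  assumes "K \<in> sets (lebn n)"
  shows "{y \<in> Rn k. embed n k b y \<in> K} \<in> sets (lebn k)"
  using measurable_sets[OF measurable_embed assms, of k b] by (simp add: vimage_def Int_def conj_commute)

text \<open>The coefficients of \<open>b'\<close> in the basis \<open>b\<close> form an orthogonal
  \<open>k\<close> by \<open>k\<close> matrix, so the two preimages of \<open>K\<close> differ by an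
  orthogonal map of \<open>Rn k\<close>, which preserves volume.\<close>

lemma secvol_change_basis:
  assumes b: "orthonormal_fam n k b" and b': "orthonormal_fam n k b'"
    and span: "\<And>j. j < k \<Longrightarrow> b' j = embed n k b (c j)"
    and K: "K \<in> sets (lebn n)"
  shows "secvol n k b' K = secvol n k b K"
proof -
  \<comment> \<open>The coefficient vectors are made extensional here, as membership in
    \<open>Rn k\<close> demands.\<close>
  define q where "q j = (\<lambda>l. if l < k then c j l else undefined)" for j
  have qb: "b' j = embed n k b (q j)" if "j < k" for j
    using span[OF that] by (simp add: embed_def q_def cong: if_cong)
  have "ipr k (q j) (q l) = (if j = l then 1 else 0)" if "j < k" "l < k" for j l
    using ipr_embed_embed[OF b, of "q j" "q l"] b' that qb by (simp add: orthonormal_fam_def ipr_def)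
  moreover have "q j \<in> Rn k" for j by (auto simp: q_def Rn_def PiE_iff extensional_def)
  ultimately have q: "orthonormal_fam k k q" by (simp add: orthonormal_fam_def)
  let ?S = "{z \<in> Rn k. embed n k b z \<in> K}"
  have "{y \<in> Rn k. embed n k b' y \<in> K} = {y \<in> Rn k. embed k k q y \<in> ?S}"
    using embed_embed[OF qb, of k] embed_Rn by auto
  then show ?thesis
    using emeasure_embed_vimage[OF q sets_embed_vimage[OF K, of k b]] by (simp add: secvol_def measure_def)
qed

lemma orthonormal_fam_upd:
  assumes "orthonormal_fam n k b" "u \<in> Rn n" "ipr n u u = 1" "\<And>j. j < k \<Longrightarrow> ipr n u (b j) = 0"
  shows "orthonormal_fam n (Suc k) (b(k := u))"
proof -
  have "ipr n (b j) u = 0" if "j < k" for j using assms(4)[OF that] by (simp add: ipr_commute)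
  then show ?thesis using assms by (auto simp: orthonormal_fam_def less_Suc_eq)
qed

lemma embed_Suc_upd: "embed n (Suc k) (b(k := u)) y = (\<lambda>i. if i < n then embed n k b y i + y k * u i else undefined)"
  by (auto simp: embed_def fun_eq_iff)

text \<open>Adding \<open>u\<close> to \<open>b\<close> gives a basis of the whole space, and the
  expansion of each \<open>b' j\<close> in it has no \<open>u\<close>-term. Hence the given bases of
  the hyperplanes may be exchanged for ones extending \<open>be\<close>.\<close>

lemma secvol_hyperplane:
  assumes b: "orthonormal_fam (Suc k) k b" "\<And>j. j < k \<Longrightarrow> ipr (Suc k) u (b j) = 0"
    and b': "orthonormal_fam (Suc k) k b'" "\<And>j. j < k \<Longrightarrow> ipr (Suc k) u (b' j) = 0"
    and u: "u \<in> Rn (Suc k)" "ipr (Suc k) u u = 1" and K: "K \<in> sets (lebn (Suc k))"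
  shows "secvol (Suc k) k b' K = secvol (Suc k) k b K"
proof (rule secvol_change_basis[OF b(1) b'(1) _ K])
  fix j assume j: "j < k"
  let ?w = "b(k := u)"
  let ?c = "\<lambda>l. ipr (Suc k) (b' j) (?w l)"
  have "b' j = embed (Suc k) (Suc k) ?w ?c"
    using orthonormal_fam_expand[OF orthonormal_fam_upd[OF b(1) u b(2)], of "b' j"] b'(1) j
    by (simp add: orthonormal_fam_def)
  moreover have "?c k = 0" using b'(2)[OF j] by (simp add: ipr_commute)
  ultimately show "b' j = embed (Suc k) k b ?c"
    unfolding embed_Suc_upd by (simp add: embed_def cong: if_cong)
qed

lemma distr_lebn_embed:
  assumes "orthonormal_fam n n w"
  shows "distr (lebn n) (lebn n) (embed n n w) = lebn n"
proof (rule measure_eqI)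
  fix A assume "A \<in> sets (distr (lebn n) (lebn n) (embed n n w))"
  then have A: "A \<in> sets (lebn n)" by simp
  have "embed n n w -` A \<inter> space (lebn n) = {y \<in> Rn n. embed n n w y \<in> A}" by auto
  then show "emeasure (distr (lebn n) (lebn n) (embed n n w)) A = emeasure (lebn n) A"
    using emeasure_embed_vimage[OF assms A] A by (simp add: emeasure_distr)
qed simp

section \<open>Measurability, boundedness, volume and barycentre of convex bodies\<close>

text \<open>Compactness refers to the topology of the full function space
  \<open>nat => real\<close>. On \<open>Rn n\<close> all coordinates from \<open>n\<close> on are
  constant, so the inclusion into that space is Borel measurable.\<close>

lemma compact_sets_lebn:
  assumes "compact K" "K \<subseteq> Rn n"
  shows "K \<in> sets (lebn n)"
proof -
  have "(\<lambda>x. x) \<in> borel_measurable (lebn n)"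
  proof (rule measurable_coordinatewise_then_product)
    fix i show "(\<lambda>x. x i) \<in> borel_measurable (lebn n)"
    proof (cases "i < n")
      case False
      have "(\<lambda>x. x i) \<in> borel_measurable (lebn n) \<longleftrightarrow> (\<lambda>x. undefined :: real) \<in> borel_measurable (lebn n)"
        using False by (intro measurable_cong) (auto simp: Rn_def PiE_iff extensional_def)
      then show ?thesis by simp
    qed simp
  qed
  moreover have "K \<in> sets borel" using assms(1) by (simp add: compact_imp_closed)
  ultimately have "(\<lambda>x. x) -` K \<inter> space (lebn n) \<in> sets (lebn n)" by (rule measurable_sets)
  then show ?thesis using assms(2) by (simp add: Int_absorb2)
qed

lemma compact_subset_cube:
  assumes "compact K" "K \<subseteq> Rn n"
  obtains R where "0 \<le> R" "K \<subseteq> cube n R"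
proof -
  have "\<exists>B. \<forall>x\<in>K. \<bar>x i\<bar> \<le> B" for i
  proof -
    have "continuous_on K (\<lambda>x. x i)"
      by (rule continuous_on_subset[OF continuous_on_product_coordinates]) simp
    from compact_imp_bounded[OF compact_continuous_image[OF this assms(1)]]
    have "bounded ((\<lambda>x. x i) ` K)" .
    then show ?thesis by (auto simp: bounded_iff)
  qed
  then obtain B where B: "\<And>i x. x \<in> K \<Longrightarrow> \<bar>x i\<bar> \<le> B i" by metis
  have "\<bar>x i\<bar> \<le> (\<Sum>i<n. \<bar>B i\<bar>)" if "x \<in> K" "i < n" for x i
    using member_le_sum[of i "{..<n}" "\<lambda>i. \<bar>B i\<bar>"] that abs_ge_self[of "B i"] B[OF that(1), of i] by simp
  then have "K \<subseteq> cube n (\<Sum>i<n. \<bar>B i\<bar>)" using assms(2) by (auto simp: cube_iff)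
  then show ?thesis using that[of "\<Sum>i<n. \<bar>B i\<bar>"] by (simp add: sum_nonneg)
qed

lemma convex_body_vol_pos:
  assumes "convex_body n K"
  shows "0 < vol n K"
proof -
  have K: "compact K" "K \<subseteq> Rn n" using assms by (auto simp: convex_body_def)
  obtain x r where x: "x \<in> K" and r: "0 < r" and ball: "{y \<in> Rn n. distn n x y < r} \<subseteq> K"
    using assms by (auto simp: convex_body_def)
  \<comment> \<open>For a point of the box the squared distance to \<open>x\<close> is at most
    \<open>n * e\<^sup>2 < (n + 1)\<^sup>2 * e\<^sup>2 = r\<^sup>2\<close>.\<close>
  define e where "e = r / (real n + 1)"
  have e: "0 < e" using r by (simp add: e_def)
  let ?Q = "Pi\<^sub>E {..<n} (\<lambda>i. {x i - e..x i + e})"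
  have "?Q \<subseteq> K"
  proof
    fix y assume y: "y \<in> ?Q"
    have "(x i - y i)\<^sup>2 \<le> e\<^sup>2" if "i < n" for i
    proof -
      have "y i \<in> {x i - e..x i + e}" using y that by (auto simp: PiE_iff)
      then have "\<bar>x i - y i\<bar> \<le> e" by (auto simp: abs_le_iff)
      then show ?thesis using abs_le_square_iff[of "x i - y i" e] e by simp
    qed
    then have "(\<Sum>i<n. (x i - y i)\<^sup>2) \<le> real n * e\<^sup>2" using sum_mono[of "{..<n}" "\<lambda>i. (x i - y i)\<^sup>2" "\<lambda>_. e\<^sup>2"] by simp
    also have "\<dots> < (real n + 1)\<^sup>2 * e\<^sup>2"
      using e by (intro mult_strict_right_mono) (auto simp: power2_eq_square algebra_simps intro: add_pos_nonneg)
    also have "\<dots> = r\<^sup>2" by (simp add: e_def power_divide)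
    finally have "distn n x y < r" using r by (simp add: distn_def real_less_lsqrt sum_nonneg)
    moreover have "y \<in> Rn n" using y by (auto simp: Rn_def PiE_iff)
    ultimately show "y \<in> K" using ball by auto
  qed
  have "emeasure (lebn n) ?Q = (\<Prod>i<n. emeasure lborel {x i - e..x i + e})"
    unfolding lebn_def by (rule lborel_nat.emeasure_PiM) auto
  also have "\<dots> = ennreal ((2 * e) ^ n)" using e by (simp add: ennreal_power)
  finally have "0 < emeasure (lebn n) ?Q" using e by simp
  also have "\<dots> \<le> emeasure (lebn n) K"
    by (rule emeasure_mono[OF \<open>?Q \<subseteq> K\<close> compact_sets_lebn[OF K]])
  finally have "0 < emeasure (lebn n) K" .
  moreover obtain R where "0 \<le> R" "K \<subseteq> cube n R" using compact_subset_cube[OF K] .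
  ultimately show ?thesis using emeasure_subset_cube(1)[of K n R] by (simp add: vol_def)
qed

text \<open>The coordinate \<open>y j\<close> is the inner product of \<open>embed n n w y\<close>
  with \<open>w j\<close>; after the measure-preserving substitution the integral is a linear
  combination of the moments that centredness annihilates.\<close>

lemma integral_embed_coordinate_zero:
  assumes K: "K \<in> sets (lebn n)" "K \<subseteq> cube n R" "0 \<le> R" and cent: "centered n K"
    and w: "orthonormal_fam n n w" and j: "j < n"
  shows "(\<integral>y. indicator {y \<in> Rn n. embed n n w y \<in> K} y * y j \<partial>lebn n) = 0"
proof -
  let ?h = "\<lambda>x. indicator K x * ipr n x (w j)"
  note [measurable] = K(1)
  have [measurable]: "(\<lambda>x. ipr n x (w j)) \<in> borel_measurable (lebn n)" unfolding ipr_def by measurable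
  have int: "integrable (lebn n) (\<lambda>x. indicator K x * x i)" if i: "i < n" for i
  proof (rule Bochner_Integration.integrable_bound)
    have "emeasure (lebn n) K < \<infinity>" using emeasure_subset_cube(1)[OF K(2,3)] by simp
    then show "integrable (lebn n) (\<lambda>x. R * indicator K x)" by (intro integrable_mult_right integrable_real_indicator) auto
    show "AE x in lebn n. norm (indicator K x * x i) \<le> norm (R * indicator K x)"
      using K(2,3) i by (intro AE_I2) (auto simp: indicator_def cube_iff)
  qed (use i in measurable)
  have "(\<integral>y. indicator {y \<in> Rn n. embed n n w y \<in> K} y * y j \<partial>lebn n) = (\<integral>y. ?h (embed n n w y) \<partial>lebn n)"
    by (intro Bochner_Integration.integral_cong) (auto simp: indicator_def ipr_embed_basis[OF w j])
  also have "\<dots> = (\<integral>x. ?h x \<partial>distr (lebn n) (lebn n) (embed n n w))"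
    by (rule integral_distr[symmetric]) auto
  also have "\<dots> = (\<integral>x. ?h x \<partial>lebn n)" by (simp add: distr_lebn_embed[OF w])
  also have "\<dots> = (\<integral>x. (\<Sum>i<n. w j i * (indicator K x * x i)) \<partial>lebn n)"
    by (simp add: ipr_def sum_distrib_left mult_ac)
  also have "\<dots> = (\<Sum>i<n. w j i * (\<integral>x. indicator K x * x i \<partial>lebn n))"
    using int by (subst Bochner_Integration.integral_sum) auto
  also have "\<dots> = 0" using cent by (simp add: centered_def set_lebesgue_integral_def)
  finally show ?thesis .
qed

lemma embed_mix: "embed n k b (mix k l x y) = mix n l (embed n k b x) (embed n k b y)"
proof
  fix i show "embed n k b (mix k l x y) i = mix n l (embed n k b x) (embed n k b y) i"
    by (auto simp: embed_def mix_def sum_distrib_left sum.distrib[symmetric] algebra_simps intro!: sum.cong)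
qed

text \<open>\<open>embed\<close> is an isometry, so \<open>\<bar>y j\<bar>\<close> is at most the
  norm of a point of the cube, which is at most \<open>sqrt n * R\<close>; the cruder factor
  \<open>n\<close> avoids the root.\<close>

lemma embed_vimage_cube:
  assumes K: "K \<subseteq> cube n R" "0 \<le> R" and w: "orthonormal_fam n n w"
  shows "{y \<in> Rn n. embed n n w y \<in> K} \<subseteq> cube n (real n * R)"
proof
  fix y assume y: "y \<in> {y \<in> Rn n. embed n n w y \<in> K}"
  let ?x = "embed n n w y"
  have "\<bar>y j\<bar> \<le> real n * R" if j: "j < n" for j
  proof (rule power2_le_imp_le[of _ "real n * R", simplified abs_ge_zero])
    have "(y j)\<^sup>2 \<le> (\<Sum>j<n. (y j)\<^sup>2)" using j by (intro member_le_sum) auto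
    also have "\<dots> = (\<Sum>i<n. (?x i)\<^sup>2)"
      using ipr_embed_embed[OF w, of y y] by (simp add: ipr_def power2_eq_square)
    also have "\<dots> \<le> (\<Sum>i<n. R\<^sup>2)"
    proof (rule sum_mono)
      fix i assume "i \<in> {..<n}"
      then have "\<bar>?x i\<bar> \<le> R" using y K(1) by (auto simp: cube_iff)
      then show "(?x i)\<^sup>2 \<le> R\<^sup>2" using abs_le_square_iff[of "?x i" R] K(2) by simp
    qed
    also have "\<dots> = real n * R\<^sup>2" by simp
    also have "\<dots> \<le> (real n * real n) * R\<^sup>2" using j by (intro mult_right_mono) auto
    also have "\<dots> = (real n * R)\<^sup>2" by (simp add: power2_eq_square)
    finally show "\<bar>y j\<bar>\<^sup>2 \<le> (real n * R)\<^sup>2" by simp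
  qed (use K(2) in simp)
  then show "y \<in> cube n (real n * R)" using y by (simp add: cube_iff)
qed

text \<open>Appending \<open>v\<close> and then \<open>u\<close> to \<open>be\<close> gives an
  orthonormal basis of the whole space. In its coordinates the hyperplane orthogonal to
  \<open>u\<close> is where the last coordinate is \<open>0\<close>, the one orthogonal to
  \<open>v\<close> where the last but one is, and their intersection is spanned by \<open>be\<close>
  itself.\<close>

lemma hyperplane_section_product_bound:
  assumes n: "n = Suc (Suc m)" and body: "convex_body n K" and cent: "centered n K"
    and u: "u \<in> Rn n" "ipr n u u = 1" and v: "v \<in> Rn n" "ipr n v v = 1" and uv: "ipr n u v = 0"
    and bu: "orthonormal_fam n (Suc m) bu" "\<And>j. j < Suc m \<Longrightarrow> ipr n u (bu j) = 0"
    and bv: "orthonormal_fam n (Suc m) bv" "\<And>j. j < Suc m \<Longrightarrow> ipr n v (bv j) = 0"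
    and be: "orthonormal_fam n m be" "\<And>j. j < m \<Longrightarrow> ipr n u (be j) = 0" "\<And>j. j < m \<Longrightarrow> ipr n v (be j) = 0"
  shows "secvol n (Suc m) bu K * secvol n (Suc m) bv K \<le> 4 * exp 6 * secvol n m be K * vol n K"
proof -
  have K: "compact K" "K \<subseteq> Rn n" using body by (auto simp: convex_body_def)
  have K_sets: "K \<in> sets (lebn n)" by (rule compact_sets_lebn[OF K])
  obtain R where R: "0 \<le> R" "K \<subseteq> cube n R" using compact_subset_cube[OF K] .
  have bev: "orthonormal_fam n (Suc m) (be(m := v))" and beu: "orthonormal_fam n (Suc m) (be(m := u))"
    using orthonormal_fam_upd[OF be(1)] u v be by auto
  let ?w = "be(m := v, Suc m := u)"
  have w: "orthonormal_fam n n ?w"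
  proof -
    have "orthonormal_fam n (Suc (Suc m)) ?w"
      by (rule orthonormal_fam_upd[OF bev u]) (use be(2) uv in \<open>auto simp: less_Suc_eq\<close>)
    then show ?thesis by (simp add: n)
  qed
  define L where "L = {y \<in> Rn n. embed n n ?w y \<in> K}"
  have embw: "embed n n ?w y = (\<lambda>i. if i < n then embed n m be y i + y m * v i + y (Suc m) * u i else undefined)" for y
    unfolding n embed_Suc_upd by (auto simp: fun_eq_iff)
  have su: "secvol n (Suc m) bu K = measure (lebn (Suc m)) {y \<in> Rn (Suc m). y(Suc m := 0) \<in> L}"
  proof -
    have "secvol n (Suc m) bu K = secvol n (Suc m) (be(m := v)) K"
      using bu bev be(2) u uv K_sets unfolding n by (intro secvol_hyperplane[of _ _ u]) (auto simp: less_Suc_eq)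
    moreover have "embed n n ?w (y(Suc m := 0)) = embed n (Suc m) (be(m := v)) y" for y
      unfolding embw embed_Suc_upd by (auto simp: embed_def fun_eq_iff)
    then have "{y \<in> Rn (Suc m). embed n (Suc m) (be(m := v)) y \<in> K} = {y \<in> Rn (Suc m). y(Suc m := 0) \<in> L}"
      by (auto simp: L_def n Rn_upd)
    ultimately show ?thesis by (simp add: secvol_def)
  qed
  have sv: "secvol n (Suc m) bv K = measure (lebn (Suc m)) {y \<in> Rn (Suc m). y(m := 0, Suc m := y m) \<in> L}"
  proof -
    have "secvol n (Suc m) bv K = secvol n (Suc m) (be(m := u)) K"
      using bv beu be(3) v uv K_sets ipr_commute[of n v u] unfolding n
      by (intro secvol_hyperplane[of _ _ v]) (auto simp: less_Suc_eq)
    moreover have "embed n n ?w (y(m := 0, Suc m := y m)) = embed n (Suc m) (be(m := u)) y" for y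
      unfolding embw embed_Suc_upd by (auto simp: embed_def fun_eq_iff)
    moreover have "y(m := 0, Suc m := y m) \<in> Rn n" if "y \<in> Rn (Suc m)" for y
      using that by (auto simp: n Rn_def PiE_iff extensional_def)
    ultimately have "{y \<in> Rn (Suc m). embed n (Suc m) (be(m := u)) y \<in> K} = {y \<in> Rn (Suc m). y(m := 0, Suc m := y m) \<in> L}"
      by (auto simp: L_def)
    then show ?thesis using \<open>secvol n (Suc m) bv K = secvol n (Suc m) (be(m := u)) K\<close> by (simp add: secvol_def)
  qed
  have se: "secvol n m be K = measure (lebn m) {y \<in> Rn m. y(m := 0, Suc m := 0) \<in> L}"
  proof -
    have "embed n n ?w (y(m := 0, Suc m := 0)) = embed n m be y" for y
      unfolding embw by (auto simp: embed_def fun_eq_iff)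
    then have "{y \<in> Rn m. embed n m be y \<in> K} = {y \<in> Rn m. y(m := 0, Suc m := 0) \<in> L}"
      by (auto simp: L_def n Rn_upd)
    then show ?thesis by (simp add: secvol_def)
  qed
  have vK: "measure (lebn n) L = vol n K"
    unfolding L_def vol_def measure_def by (simp add: emeasure_embed_vimage[OF w K_sets])
  have Ls: "L \<in> sets (lebn n)" unfolding L_def by (rule sets_embed_vimage[OF K_sets])
  have Lc: "L \<subseteq> cube n (real n * R)" unfolding L_def by (rule embed_vimage_cube[OF R(2,1) w])
  have conv: "mix n l x y \<in> L" if "x \<in> L" "y \<in> L" "0 < l" "l < 1" for x y l
  proof -
    have "mix n l (embed n n ?w x) (embed n n ?w y) \<in> K"
      using body that by (auto simp: convex_body_def convex_n_def mix_def L_def)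
    then show ?thesis by (simp add: L_def mix_Rn embed_mix)
  qed
  have c: "(\<integral>x. indicator L x * x j \<partial>lebn n) = 0" if "j < n" for j
    unfolding L_def by (rule integral_embed_coordinate_zero[OF K_sets R(2,1) cent w that])
  have "0 < measure (lebn n) L" unfolding vK by (rule convex_body_vol_pos[OF body])
  with coordinate_section_product_bound[of L m "real n * R"] Ls Lc conv c[of m] c[of "Suc m"] R(1)
  show ?thesis unfolding su sv se vK[symmetric] unfolding n by simp
qed

theorem mainTheorem4:
  "\<exists>c>0. \<forall>n\<ge>3. \<forall>K u v bu bv be.
     convex_body n K \<and> centered n K \<and>
     u \<in> Rn n \<and> v \<in> Rn n \<and> ipr n u u = 1 \<and> ipr n v v = 1 \<and> ipr n u v = 0 \<and>
     orthonormal_fam n (n - 1) bu \<and> (\<forall>j<n - 1. ipr n u (bu j) = 0) \<and>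
     orthonormal_fam n (n - 1) bv \<and> (\<forall>j<n - 1. ipr n v (bv j) = 0) \<and>
     orthonormal_fam n (n - 2) be \<and> (\<forall>j<n - 2. ipr n u (be j) = 0 \<and> ipr n v (be j) = 0)
     \<longrightarrow> secvol n (n - 1) bu K * secvol n (n - 1) bv K \<le> c * secvol n (n - 2) be K * vol n K"
proof (intro exI[of _ "4 * exp 6"] conjI allI impI)
  fix n :: nat and K :: "(nat \<Rightarrow> real) set" and u v :: "nat \<Rightarrow> real" and bu bv be :: "nat \<Rightarrow> nat \<Rightarrow> real"
  assume "3 \<le> n"
  then have "n = Suc (Suc (n - 2))" by simp
  then obtain m where n: "n = Suc (Suc m)" by blast
  assume *: "convex_body n K \<and> centered n K \<and>
     u \<in> Rn n \<and> v \<in> Rn n \<and> ipr n u u = 1 \<and> ipr n v v = 1 \<and> ipr n u v = 0 \<and>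
     orthonormal_fam n (n - 1) bu \<and> (\<forall>j<n - 1. ipr n u (bu j) = 0) \<and>
     orthonormal_fam n (n - 1) bv \<and> (\<forall>j<n - 1. ipr n v (bv j) = 0) \<and>
     orthonormal_fam n (n - 2) be \<and> (\<forall>j<n - 2. ipr n u (be j) = 0 \<and> ipr n v (be j) = 0)"
  show "secvol n (n - 1) bu K * secvol n (n - 1) bv K \<le> 4 * exp 6 * secvol n (n - 2) be K * vol n K"
  proof -
    have n1: "n - 1 = Suc m" and n2: "n - 2 = m" using n by simp_all
    show ?thesis
      unfolding n1 n2 by (rule hyperplane_section_product_bound[OF n, of K u v bu bv be]) (use *[unfolded n1 n2] in simp_all)
  qed
qed simp

end
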